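(* Let $f,g:\mathbb{R}^{d_x}\times\mathbb{R}^{d_y}\to\mathbb{R}$ satisfy Assumptions 1 and 2 stated in the context, and let $(x^0,y^0)$ be an initial point. Then there exist step sizes $\alpha,\beta,\rho>0$ and an integer $N\ge 1$, all independent of $K$, and integers $T=T_K\ge 1$ with $T_K=\mathcal{O}(\log K)$, such that the iterates of the GALET algorithm (described in the context) run for $K$ outer iterations with parameters $\alpha,\beta,\rho,N,T_K$ satisfy, as $K\to\infty$, $$\frac1K\sum_{k=0}^{K-1}\mathcal{R}_x(x^k,y^k,w^k)=\mathcal{O}\left(\frac1K\right),\quad \frac1K\sum_{k=0}^{K-1}\mathcal{R}_w(x^k,y^k,w^k)=\mathcal{O}\left(\frac1K\right),\quad \frac1K\sum_{k=0}^{K-1}\mathcal{R}_y(x^k,y^k)=\mathcal{O}\left(\frac1K\right),$$ where the constants hidden in $\mathcal{O}(\cdot)$ do not depend on $K$.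
   Context: Bilevel problem: $\min_{x\in\mathbb{R}^{d_x},\,y\in S(x)} f(x,y)$ with $S(x)=\arg\min_{y\in\mathbb{R}^{d_y}} g(x,y)$ and $g^*(x):=\min_y g(x,y)$ (attained). The optimal value of the bilevel problem is finite. Assumption 1: $\nabla f,\nabla g,\nabla^2 g$ are Lipschitz continuous in $(x,y)$ with constants $\ell_{f,1},\ell_{g,1},\ell_{g,2}$ respectively, and $f(x,\cdot)$ is $\ell_{f,0}$-Lipschitz continuous for every $x$. Assumption 2: $g$ is $\mu_g$-PL in $y$, i.e. $\mu_g>0$ and $\|\nabla_y g(x,y)\|^2\ge 2\mu_g(g(x,y)-g^*(x))$ for all $x,y$. Moreover $\sigma_g:=\inf_{x,y}\sigma_{\min}^+(\nabla_{yy}^2g(x,y))>0$, where $\sigma_{\min}^+(A)$ is the smallest positive singular value of $A$. Notation: $\nabla_{xy}^2 g(x,y)\in\mathbb{R}^{d_x\times d_y}$ is the matrix for which $\nabla_{xy}^2 g(x,y)w$ is the gradient in $x$ of $\nabla_y g(x,y)^\top w$. GALET algorithm with parameters $\alpha,\beta,\rho>0$ and integers $N,T\ge1$, started at $(x^0,y^0)$, with $w^0=0$. For $k=0,\dots,K-1$: (i) set $y^{k,0}=y^k$; for $n=0,\dots,N-1$, $y^{k,n+1}=y^{k,n}-\beta\nabla_y g(x^k,y^{k,n})$; set $y^{k+1}=y^{k,N}$; (ii) set $w^{k,0}=0$; for $t=0,\dots,T-1$, $w^{k,t+1}=w^{k,t}-\rho\,\nabla_{yy}^2g(x^k,y^{k+1})\left(\nabla_y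 f(x^k,y^{k+1})+\nabla_{yy}^2g(x^k,y^{k+1})w^{k,t}\right)$; set $w^{k+1}=w^{k,T}$; (iii) set $d_x^k=\nabla_x f(x^k,y^{k+1})+\nabla_{xy}^2g(x^k,y^{k+1})w^{k+1}$ and $x^{k+1}=x^k-\alpha d_x^k$. Residuals: $\mathcal{R}_x(x,y,w)=\|\nabla_x f(x,y)+\nabla_{xy}^2g(x,y)w\|^2$, $\mathcal{R}_w(x,y,w)=\|\nabla_{yy}^2g(x,y)(\nabla_y f(x,y)+\nabla_{yy}^2g(x,y)w)\|^2$, $\mathcal{R}_y(x,y)=g(x,y)-g^*(x)$. *)

theory Defs
  imports "HOL-Analysis.Analysis" "HOL-Library.Landau_Symbols"
begin

definition gradient :: "('a::real_inner \<Rightarrow> real) \<Rightarrow> 'a \<Rightarrow> 'a" where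
  "gradient h z = (THE D. GDERIV h z :> D)"

lemma gradient_eqI:
  assumes "GDERIV h z :> D"
  shows "gradient h z = D"
  unfolding gradient_def
proof (rule the_equality)
  show "GDERIV h z :> D" by (fact assms)
next
  fix E assume "GDERIV h z :> E"
  with assms have eq: "(\<lambda>v. v \<bullet> E) = (\<lambda>v. v \<bullet> D)"
    unfolding gderiv_def by (rule has_derivative_unique[rotated])
  have "(E - D) \<bullet> (E - D) = 0"
    using fun_cong[OF eq, of "E - D"] by (simp only: inner_diff_right)
  thus "E = D" by simp
qed

lemma GDERIV_gradient:
  fixes h :: "'a::euclidean_space \<Rightarrow> real"
  assumes "h differentiable (at z)"
  shows "GDERIV h z :> gradient h z"
proof -
  obtain h' where h': "(h has_derivative h') (at z)"
    using assms by (auto simp: differentiable_def)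
  have "h' = (\<lambda>v. v \<bullet> adjoint h' 1)"
    using adjoint_works[OF has_derivative_linear[OF h'], of _ 1] by (auto simp: fun_eq_iff)
  with h' have D: "GDERIV h z :> adjoint h' 1" by (simp add: gderiv_def)
  show ?thesis using D gradient_eqI[OF D] by simp
qed

definition grad_x :: "('a::real_inner \<times> 'b::real_inner \<Rightarrow> real) \<Rightarrow> 'a \<times> 'b \<Rightarrow> 'a" where
  "grad_x h z = gradient (\<lambda>x. h (x, snd z)) (fst z)"

definition grad_y :: "('a::real_inner \<times> 'b::real_inner \<Rightarrow> real) \<Rightarrow> 'a \<times> 'b \<Rightarrow> 'b" where
  "grad_y h z = gradient (\<lambda>y. h (fst z, y)) (snd z)"

(* The full Hessian is a bounded linear map, so that distances between Hessians are measured
   in the operator (spectral) norm. It is meaningful only where the gradient of h is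
   differentiable. *)
definition hessian :: "('a::real_inner \<Rightarrow> real) \<Rightarrow> 'a \<Rightarrow> 'a \<Rightarrow>\<^sub>L 'a" where
  "hessian h z = Blinfun (frechet_derivative (gradient h) (at z))"

definition hess_yy :: "((real^'m) \<times> (real^'n) \<Rightarrow> real) \<Rightarrow> (real^'m) \<times> (real^'n) \<Rightarrow> real^'n^'n" where
  "hess_yy h z = jacobian (\<lambda>y. grad_y h (fst z, y)) (at (snd z))"

definition hess_xy :: "((real^'m) \<times> (real^'n) \<Rightarrow> real) \<Rightarrow> (real^'m) \<times> (real^'n) \<Rightarrow> real^'n^'m" where
  "hess_xy h z = matrix (\<lambda>w. gradient (\<lambda>x. grad_y h (x, snd z) \<bullet> w) (fst z))"

lemma hess_xy_works:
  fixes h :: "(real^'m) \<times> (real^'n) \<Rightarrow> real"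
  assumes "(\<lambda>x. grad_y h (x, y)) differentiable (at x)"
  shows "hess_xy h (x, y) *v w = gradient (\<lambda>x. grad_y h (x, y) \<bullet> w) x"
proof -
  obtain G where G: "((\<lambda>x. grad_y h (x, y)) has_derivative G) (at x)"
    using assms by (auto simp: differentiable_def)
  have "GDERIV (\<lambda>x. grad_y h (x, y) \<bullet> w) x :> adjoint G w" for w
    unfolding gderiv_def adjoint_works[OF has_derivative_linear[OF G]]
    by (rule has_derivative_inner_left[OF G])
  hence "gradient (\<lambda>x. grad_y h (x, y) \<bullet> w) x = adjoint G w" for w
    by (rule gradient_eqI)
  moreover have "linear (adjoint G)"
    by (rule adjoint_linear[OF has_derivative_linear[OF G]])
  ultimately show ?thesis
    unfolding hess_xy_def by (simp add: matrix_works)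
qed

definition singular_value :: "real^'n^'m \<Rightarrow> real \<Rightarrow> bool" where
  "singular_value A s \<longleftrightarrow>
     0 \<le> s \<and> (\<exists>v. v \<noteq> 0 \<and> (transpose A ** A) *v v = s\<^sup>2 *\<^sub>R v)"

(* Extended-real valued: the zero matrix has no positive singular value and gets the value
   infinity, so it does not constrain an infimum over a family of matrices. *)
definition sigma_min_pos :: "real^'n^'m \<Rightarrow> ereal" where
  "sigma_min_pos A = Inf (ereal ` {s. singular_value A s \<and> 0 < s})"

definition lower_solutions :: "('a \<times> 'b \<Rightarrow> real) \<Rightarrow> 'a \<Rightarrow> 'b set" where
  "lower_solutions g x = {y. \<forall>y'. g (x, y) \<le> g (x, y')}"

definition lower_value :: "('a \<times> 'b \<Rightarrow> real) \<Rightarrow> 'a \<Rightarrow> real" where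
  "lower_value g x = (INF y. g (x, y))"

definition bilevel_value :: "('a \<times> 'b \<Rightarrow> real) \<Rightarrow> ('a \<times> 'b \<Rightarrow> real) \<Rightarrow> ereal" where
  "bilevel_value f g = (INF z\<in>{(x, y). y \<in> lower_solutions g x}. ereal (f z))"

definition well_posed_bilevel :: "('a \<times> 'b \<Rightarrow> real) \<Rightarrow> ('a \<times> 'b \<Rightarrow> real) \<Rightarrow> bool" where
  "well_posed_bilevel f g \<longleftrightarrow>
     (\<forall>x. lower_solutions g x \<noteq> {}) \<and> \<bar>bilevel_value f g\<bar> \<noteq> \<infinity>"

definition smoothness_assumption ::
  "real \<Rightarrow> real \<Rightarrow> real \<Rightarrow> real \<Rightarrow>
   ((real^'m) \<times> (real^'n) \<Rightarrow> real) \<Rightarrow> ((real^'m) \<times> (real^'n) \<Rightarrow> real) \<Rightarrow> bool" where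
  "smoothness_assumption lf0 lf1 lg1 lg2 f g \<longleftrightarrow>
     (\<forall>z. f differentiable (at z)) \<and>
     (\<forall>z. g differentiable (at z)) \<and>
     (\<forall>z. gradient g differentiable (at z)) \<and>
     lf1-lipschitz_on UNIV (gradient f) \<and>
     lg1-lipschitz_on UNIV (gradient g) \<and>
     lg2-lipschitz_on UNIV (hessian g) \<and>
     (\<forall>x. lf0-lipschitz_on UNIV (\<lambda>y. f (x, y)))"

definition pl_assumption :: "real \<Rightarrow> ((real^'m) \<times> (real^'n) \<Rightarrow> real) \<Rightarrow> bool" where
  "pl_assumption mu g \<longleftrightarrow>
     0 < mu \<and>
     (\<forall>x y. (norm (grad_y g (x, y)))\<^sup>2 \<ge> 2 * mu * (g (x, y) - lower_value g x)) \<and>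
     0 < (INF z. sigma_min_pos (hess_yy g z))"

definition y_step :: "real \<Rightarrow> ((real^'m) \<times> (real^'n) \<Rightarrow> real) \<Rightarrow> real^'m \<Rightarrow> real^'n \<Rightarrow> real^'n" where
  "y_step \<beta> g x y = y - \<beta> *\<^sub>R grad_y g (x, y)"

definition w_step ::
  "real \<Rightarrow> ((real^'m) \<times> (real^'n) \<Rightarrow> real) \<Rightarrow> ((real^'m) \<times> (real^'n) \<Rightarrow> real) \<Rightarrow>
   (real^'m) \<times> (real^'n) \<Rightarrow> real^'n \<Rightarrow> real^'n" where
  "w_step \<rho> f g z w = w - \<rho> *\<^sub>R (hess_yy g z *v (grad_y f z + hess_yy g z *v w))"

definition galet_step ::
  "real \<Rightarrow> real \<Rightarrow> real \<Rightarrow> nat \<Rightarrow> nat \<Rightarrow>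
   ((real^'m) \<times> (real^'n) \<Rightarrow> real) \<Rightarrow> ((real^'m) \<times> (real^'n) \<Rightarrow> real) \<Rightarrow>
   (real^'m) \<times> (real^'n) \<times> (real^'n) \<Rightarrow> (real^'m) \<times> (real^'n) \<times> (real^'n)" where
  "galet_step \<alpha> \<beta> \<rho> N T f g = (\<lambda>(x, y, w).
     let y' = (y_step \<beta> g x ^^ N) y;
         w' = (w_step \<rho> f g (x, y') ^^ T) 0;
         d = grad_x f (x, y') + hess_xy g (x, y') *v w'
     in (x - \<alpha> *\<^sub>R d, y', w'))"

primrec galet ::
  "real \<Rightarrow> real \<Rightarrow> real \<Rightarrow> nat \<Rightarrow> nat \<Rightarrow>
   ((real^'m) \<times> (real^'n) \<Rightarrow> real) \<Rightarrow> ((real^'m) \<times> (real^'n) \<Rightarrow> real) \<Rightarrow>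
   real^'m \<Rightarrow> real^'n \<Rightarrow> nat \<Rightarrow> (real^'m) \<times> (real^'n) \<times> (real^'n)" where
  "galet \<alpha> \<beta> \<rho> N T f g x0 y0 0 = (x0, y0, 0)"
| "galet \<alpha> \<beta> \<rho> N T f g x0 y0 (Suc k) =
     galet_step \<alpha> \<beta> \<rho> N T f g (galet \<alpha> \<beta> \<rho> N T f g x0 y0 k)"

(* All three residuals take the iterate (x, y, w); res_y does not depend on w. *)
definition res_x ::
  "((real^'m) \<times> (real^'n) \<Rightarrow> real) \<Rightarrow> ((real^'m) \<times> (real^'n) \<Rightarrow> real) \<Rightarrow>
   (real^'m) \<times> (real^'n) \<times> (real^'n) \<Rightarrow> real" where
  "res_x f g = (\<lambda>(x, y, w). (norm (grad_x f (x, y) + hess_xy g (x, y) *v w))\<^sup>2)"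

definition res_w ::
  "((real^'m) \<times> (real^'n) \<Rightarrow> real) \<Rightarrow> ((real^'m) \<times> (real^'n) \<Rightarrow> real) \<Rightarrow>
   (real^'m) \<times> (real^'n) \<times> (real^'n) \<Rightarrow> real" where
  "res_w f g = (\<lambda>(x, y, w).
     (norm (hess_yy g (x, y) *v (grad_y f (x, y) + hess_yy g (x, y) *v w)))\<^sup>2)"

definition res_y ::
  "((real^'m) \<times> (real^'n) \<Rightarrow> real) \<Rightarrow> (real^'m) \<times> (real^'n) \<times> (real^'n) \<Rightarrow> real" where
  "res_y g = (\<lambda>(x, y, w). g (x, y) - lower_value g x)"

end

theory Submission
  imports Defs
begin

text \<open>
Write \<open>d\<close> for the direction of the \<open>x\<close>-step, \<open>R = g - g*\<close> for the lower-level gap,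
\<open>H\<close> for the \<open>yy\<close>-block of the Hessian of \<open>g\<close>, and
let \<open>w*(z)\<close> be the least-norm solution \<open>w\<close> of \<open>H (grad_y f + H w) = 0\<close> at \<open>z = (x, y)\<close>.
A single lower-level gradient step per round suffices. With step sizes \<open>\<beta> = 1 / (2 L)\<close>,
\<open>\<rho> = 1 / L\<^sup>2\<close> and small \<open>\<alpha>\<close>, the function
\<open>V = f + w* \<bullet> grad_y g + c R\<close> drops in each round by at least \<open>\<alpha> / 4 |d|\<^sup>2 + R\<close>, up to an
error coming from the inexact \<open>w\<close> (\<open>lyapunov_decrease\<close>). The \<open>w\<close>-iteration converges
geometrically to \<open>w*\<close>, so about \<open>ln K\<close> of its steps make the squared error \<open>O(1/K)\<close>, and over
\<open>K\<close> rounds the errors add up to a constant. As \<open>V\<close> is bounded below, the sums of \<open>|d|\<^sup>2\<close> and of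
\<open>R\<close> stay bounded independently of \<open>K\<close>.

The decrease of \<open>V\<close> rests on the fact that every term which could be of first order is in fact quadratic.
In \<open>x\<close>, the partial gradient of \<open>f + w \<bullet> grad_y g\<close> at \<open>w = w*\<close> is the direction that \<open>d\<close>
approximates. In \<open>y\<close>, the step is along \<open>grad_y g\<close>, while the partial gradient
\<open>grad_y f + H w*\<close> lies in the kernel of \<open>H\<close>. Now \<open>grad_y g\<close> vanishes at a lower-level solution whose squared
distance is \<open>O(R)\<close> by the PL inequality (\<open>error_bound\<close>), and the linear term of its expansion
lies in the range of \<open>H\<close>, which is orthogonal to that kernel; what remains is \<open>O(R)\<close>
(\<open>kernel_part_of_grad_y\<close>). The change of \<open>w*\<close> itself is multiplied by \<open>grad_y g\<close>, which is
\<open>O(sqrt R)\<close>, so it is quadratic as well once \<open>w*\<close> is Lipschitz. Finally \<open>R\<close> contracts in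
the \<open>y\<close>-step, which pays for all multiples of \<open>R\<close> when \<open>c\<close> is large
(\<open>R_change_x\<close>).

The Lipschitz property of \<open>w*\<close> comes from the uniform spectral gap. If \<open>A\<close> and \<open>B\<close> are
symmetric with no nonzero eigenvalue of modulus below \<open>\<sigma>\<close>, then the range of one and the kernel of the other
are orthogonal up to \<open>|A - B| / \<sigma>\<close> (\<open>range_kernel_almost_orthogonal\<close>), and this controls
the difference of least-norm solutions (\<open>min_norm_solution_lipschitz\<close>).

The \<open>x\<close>- and \<open>w\<close>-residuals at \<open>(x\<^sup>k, y\<^sup>k, w\<^sup>k)\<close> differ from the quantities just summed because
\<open>y\<^sup>k\<close> and \<open>w\<^sup>k\<close> were computed at the previous point \<open>x\<^sup>k\<^sup>-\<^sup>1\<close>; the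
difference is of order \<open>|x\<^sup>k - x\<^sup>k\<^sup>-\<^sup>1| = \<alpha> |d|\<close>, whose square is again summable.
\<close>

section \<open>Auxiliary inequalities\<close>

lemma le_if_le_add_small_multiple:
  fixes a b c :: real
  assumes "\<And>t. 0 < t \<Longrightarrow> a \<le> b + t * c"
  shows "a \<le> b"
proof (rule field_le_epsilon)
  fix e :: real assume e: "0 < e"
  have "a \<le> b + (e / (\<bar>c\<bar> + 1)) * c" using e by (intro assms) simp
  also have "(e / (\<bar>c\<bar> + 1)) * c \<le> (e / (\<bar>c\<bar> + 1)) * (\<bar>c\<bar> + 1)"
    using e by (intro mult_left_mono) auto
  also have "\<dots> = e" by (simp add: field_simps add_nonneg_eq_0_iff)
  finally show "a \<le> b + e" by simp
qed

lemma norm_snd: "norm (snd p) \<le> norm p"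
  by (cases p) (simp add: norm_snd_le)

lemma norm_fst: "norm (fst p) \<le> norm p"
  by (cases p) (simp add: norm_fst_le)

lemma sum_le_first_plus_shifted:
  fixes r :: "nat \<Rightarrow> real"
  assumes "\<And>k. 0 \<le> r k" "\<And>k. r (Suc k) \<le> b k"
  shows "(\<Sum>k<K. r k) \<le> r 0 + (\<Sum>k<K. b k)"
proof -
  have "(\<Sum>k<K. r k) \<le> (\<Sum>k<Suc K. r k)" using assms(1) by simp
  also have "\<dots> = r 0 + (\<Sum>k<K. r (Suc k))" by (rule sum.lessThan_Suc_shift)
  also have "\<dots> \<le> r 0 + (\<Sum>k<K. b k)" by (intro add_left_mono sum_mono assms)
  finally show ?thesis .
qed

section \<open>Functions with Lipschitz derivatives\<close>

text \<open>
The mean value inequality loses the factor 1/2 of the sharp Taylor bound; only the order of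
magnitude matters for the sequel.
\<close>
lemma linearization_error:
  fixes h :: "'a::euclidean_space \<Rightarrow> 'b::real_normed_vector" and D :: "'a \<Rightarrow> 'a \<Rightarrow>\<^sub>L 'b"
  assumes der: "\<And>z. (h has_derivative blinfun_apply (D z)) (at z)"
    and lip: "\<And>z z'. norm (D z - D z') \<le> M * norm (z - z')"
  shows "norm (h (z + v) - h z - D z v) \<le> M * (norm v)\<^sup>2"
proof -
  have M: "0 \<le> M * norm v" using order_trans[OF norm_ge_zero lip[of "z + v" z]] by simp
  have "norm (h (z + v) - h z - D z (z + v - z)) \<le> norm (z + v - z) * (M * norm v)"
  proof (rule differentiable_bound_linearization[where S = "closed_segment z (z + v)"])
    show "z + t *\<^sub>R (z + v - z) \<in> closed_segment z (z + v)" if "t \<in> {0..1}" for t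
      using that by (auto simp: closed_segment_def algebra_simps intro!: exI[of _ t])
    show "(h has_derivative blinfun_apply (D x)) (at x within closed_segment z (z + v))" for x
      by (rule has_derivative_at_withinI[OF der])
    show "onorm (blinfun_apply (D x) - blinfun_apply (D z)) \<le> M * norm v"
      if "x \<in> closed_segment z (z + v)" for x
    proof -
      have "blinfun_apply (D x) - blinfun_apply (D z) = blinfun_apply (D x - D z)"
        by (auto simp: blinfun.diff_left)
      moreover have "norm (x - z) \<le> norm v"
        using segment_bound1[OF that] by simp
      moreover have "0 \<le> M" if "v \<noteq> 0" using M that by (simp add: zero_le_mult_iff)
      ultimately show ?thesis using lip[of x z] that
        by (cases "v = 0") (auto simp: norm_blinfun.rep_eq[symmetric] intro: order_trans mult_left_mono)
    qed
  qed auto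
  then show ?thesis by (simp add: power2_eq_square mult.left_commute mult.commute)
qed

lemma linearization_error_gradient:
  fixes h :: "'a::euclidean_space \<Rightarrow> real"
  assumes der: "\<And>z. GDERIV h z :> G z"
    and lip: "\<And>z z'. norm (G z - G z') \<le> M * norm (z - z')"
  shows "\<bar>h (z + v) - h z - G z \<bullet> v\<bar> \<le> M * (norm v)\<^sup>2"
proof -
  have "norm (blinfun_inner_left (G z) - blinfun_inner_left (G z')) \<le> M * norm (z - z')" for z z'
  proof -
    have "blinfun_inner_left (G z) - blinfun_inner_left (G z') = blinfun_inner_left (G z - G z')"
      by (rule blinfun_eqI) (simp add: blinfun.diff_left inner_diff_right)
    moreover have "norm (blinfun_inner_left (G z - G z')) \<le> norm (G z - G z')"
      by (rule norm_blinfun_bound) (auto simp: Cauchy_Schwarz_ineq2 mult.commute)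
    ultimately show ?thesis using lip[of z z'] by simp
  qed
  from linearization_error[OF _ this, of h z v] der show ?thesis
    by (simp add: gderiv_def inner_commute)
qed

text \<open>
The difference quotient at step \<open>t\<close> is at most the Lipschitz constant and differs from the
derivative by \<open>O(t)\<close>; let \<open>t\<close> tend to 0.
\<close>
lemma norm_derivative_le_lipschitz:
  fixes h :: "'a::euclidean_space \<Rightarrow> 'b::real_normed_vector" and D :: "'a \<Rightarrow> 'a \<Rightarrow>\<^sub>L 'b"
  assumes der: "\<And>z. (h has_derivative blinfun_apply (D z)) (at z)"
    and lip: "\<And>z z'. norm (D z - D z') \<le> M * norm (z - z')"
    and L: "\<And>z z'. norm (h z - h z') \<le> L * norm (z - z')"
  shows "norm (D z v) \<le> L * norm v"
proof (rule le_if_le_add_small_multiple)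
  fix t :: real assume t: "0 < t"
  have "t * norm (D z v) = norm (D z (t *\<^sub>R v))" using t by (simp add: blinfun.scaleR_right)
  also have "\<dots> \<le> norm (h (z + t *\<^sub>R v) - h z) + norm (h (z + t *\<^sub>R v) - h z - D z (t *\<^sub>R v))"
    using norm_triangle_sub[of "D z (t *\<^sub>R v)" "h (z + t *\<^sub>R v) - h z"]
    by (simp add: norm_minus_commute)
  also have "\<dots> \<le> L * norm (t *\<^sub>R v) + M * (norm (t *\<^sub>R v))\<^sup>2"
    using L[of "z + t *\<^sub>R v" z] linearization_error[OF der lip, of z "t *\<^sub>R v"] by simp
  also have "\<dots> = t * (L * norm v + t * (M * (norm v)\<^sup>2))"
    using t by (simp add: power2_eq_square algebra_simps)
  finally show "norm (D z v) \<le> L * norm v + t * (M * (norm v)\<^sup>2)" using t by simp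
qed

text \<open>
The mean value theorem in the direction \<open>u\<close> turns the second difference, which is symmetric in
\<open>u\<close> and \<open>v\<close>, into a difference of gradients, and linearising these leaves the
Hessian term with a cubic error.
\<close>
lemma second_difference_estimate:
  fixes g :: "'a::euclidean_space \<Rightarrow> real"
  assumes g: "\<And>z. GDERIV g z :> G z"
    and G: "\<And>z. (G has_derivative blinfun_apply (D z)) (at z)"
    and lip: "\<And>z z'. norm (D z - D z') \<le> M * norm (z - z')"
    and t: "0 < t"
  shows "\<bar>g (z + t *\<^sub>R u + t *\<^sub>R v) - g (z + t *\<^sub>R u) - g (z + t *\<^sub>R v) + g z - t\<^sup>2 * (u \<bullet> D z v)\<bar>
         \<le> t ^ 3 * (2 * \<bar>M\<bar> * (norm u + norm v) ^ 3)"
proof -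
  let ?p = "\<lambda>s. g (z + s *\<^sub>R u + t *\<^sub>R v) - g (z + s *\<^sub>R u)"
  let ?E = "\<lambda>w. G (z + w) - G z - D z w"
  have gd: "((\<lambda>s. g (c + s *\<^sub>R u)) has_derivative (\<lambda>d. (d *\<^sub>R u) \<bullet> G (c + s *\<^sub>R u))) (at s)" for c s
  proof -
    have "((\<lambda>s. c + s *\<^sub>R u) has_derivative (\<lambda>d. d *\<^sub>R u)) (at s)"
      by (auto intro!: derivative_eq_intros)
    from has_derivative_compose[OF this, of g "\<lambda>h. h \<bullet> G (c + s *\<^sub>R u)"] g show ?thesis
      by (simp add: gderiv_def)
  qed
  have "(?p has_derivative
      (\<lambda>d. (d *\<^sub>R u) \<bullet> (G (z + s *\<^sub>R u + t *\<^sub>R v) - G (z + s *\<^sub>R u)))) (at s)" for s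
    using has_derivative_diff[OF gd[of "z + t *\<^sub>R v" s] gd[of z s]]
    by (simp add: inner_diff_right add_ac)
  then have "(?p has_derivative
      (\<lambda>d. (d *\<^sub>R u) \<bullet> (G (z + s *\<^sub>R u + t *\<^sub>R v) - G (z + s *\<^sub>R u)))) (at s within {0..t})" for s
    by (rule has_derivative_at_withinI)
  then obtain s where s: "0 < s" "s < t"
    and S: "?p t - ?p 0 = ((t - 0) *\<^sub>R u) \<bullet> (G (z + s *\<^sub>R u + t *\<^sub>R v) - G (z + s *\<^sub>R u))"
    using mvt_simple[OF t, of ?p "\<lambda>s d. (d *\<^sub>R u) \<bullet> (G (z + s *\<^sub>R u + t *\<^sub>R v) - G (z + s *\<^sub>R u))"]
    by (metis (no_types, lifting) greaterThanLessThan_iff)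
  define p where "p = s *\<^sub>R u + t *\<^sub>R v"
  define q where "q = s *\<^sub>R u"
  have "G (z + s *\<^sub>R u + t *\<^sub>R v) - G (z + s *\<^sub>R u) = ?E p - ?E q + t *\<^sub>R D z v"
    by (simp add: p_def q_def blinfun.add_right blinfun.scaleR_right add_ac)
  then have "?p t - ?p 0 - t\<^sup>2 * (u \<bullet> D z v) = t * (u \<bullet> (?E p - ?E q))"
    using S by (simp only: inner_add_right inner_scaleR_right inner_scaleR_left)
      (simp add: power2_eq_square distrib_left)
  moreover have "\<bar>u \<bullet> (?E p - ?E q)\<bar> \<le> norm u * (2 * \<bar>M\<bar> * (t * (norm u + norm v))\<^sup>2)"
  proof -
    have b: "norm (?E w) \<le> \<bar>M\<bar> * (t * (norm u + norm v))\<^sup>2" if "norm w \<le> t * (norm u + norm v)" for w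
    proof -
      have "norm (?E w) \<le> M * (norm w)\<^sup>2" by (rule linearization_error[OF G lip])
      also have "\<dots> \<le> \<bar>M\<bar> * (norm w)\<^sup>2" by (intro mult_right_mono) auto
      also have "\<dots> \<le> \<bar>M\<bar> * (t * (norm u + norm v))\<^sup>2"
        using that by (intro mult_left_mono power_mono) auto
      finally show ?thesis .
    qed
    have su: "s * norm u \<le> t * norm u" "0 \<le> t * norm v" using s t by (auto intro: mult_right_mono)
    have "norm p \<le> t * (norm u + norm v)"
      unfolding p_def using norm_triangle_ineq[of "s *\<^sub>R u" "t *\<^sub>R v"] s t su
      by (simp add: algebra_simps)
    moreover have "norm q = s * norm u" using s by (simp add: q_def)
    then have "norm q \<le> t * (norm u + norm v)" using su unfolding distrib_left by linarith
    ultimately have "norm (?E p - ?E q) \<le> 2 * \<bar>M\<bar> * (t * (norm u + norm v))\<^sup>2"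
      using norm_triangle_ineq4[of "?E p" "?E q"] b[of p] b[of q] by linarith
    then show ?thesis
      by (intro order_trans[OF Cauchy_Schwarz_ineq2 mult_left_mono]) auto
  qed
  ultimately have "\<bar>?p t - ?p 0 - t\<^sup>2 * (u \<bullet> D z v)\<bar> \<le> t * (norm u * (2 * \<bar>M\<bar> * (t * (norm u + norm v))\<^sup>2))"
    using t by (simp add: abs_mult)
  also have "\<dots> \<le> t * ((norm u + norm v) * (2 * \<bar>M\<bar> * (t * (norm u + norm v))\<^sup>2))"
    using t by (intro mult_left_mono mult_right_mono) auto
  also have "\<dots> = t ^ 3 * (2 * \<bar>M\<bar> * (norm u + norm v) ^ 3)"
    by (simp add: power2_eq_square power3_eq_cube mult_ac)
  finally show ?thesis by (simp add: algebra_simps)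
qed

text \<open>
Compare the two expansions of the same second difference, divide by \<open>t\<^sup>2\<close> and let \<open>t\<close> tend to 0.
\<close>
lemma second_derivative_symmetric:
  fixes g :: "'a::euclidean_space \<Rightarrow> real"
  assumes g: "\<And>z. GDERIV g z :> G z"
    and G: "\<And>z. (G has_derivative blinfun_apply (D z)) (at z)"
    and lip: "\<And>z z'. norm (D z - D z') \<le> M * norm (z - z')"
  shows "u \<bullet> D z v = D z u \<bullet> v"
proof -
  let ?C = "4 * \<bar>M\<bar> * (norm u + norm v) ^ 3"
  have "\<bar>u \<bullet> D z v - v \<bullet> D z u\<bar> \<le> 0"
  proof (rule le_if_le_add_small_multiple)
    fix t :: real assume t: "0 < t"
    have "\<bar>t\<^sup>2 * (u \<bullet> D z v) - t\<^sup>2 * (v \<bullet> D z u)\<bar> \<le> t ^ 3 * ?C"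
      using second_difference_estimate[OF g G lip t, of z u v]
        second_difference_estimate[OF g G lip t, of z v u]
      by (simp add: add_ac)
    then have "t\<^sup>2 * \<bar>u \<bullet> D z v - v \<bullet> D z u\<bar> \<le> t\<^sup>2 * (t * ?C)"
      by (simp add: right_diff_distrib[symmetric] abs_mult power2_eq_square power3_eq_cube mult_ac)
    then show "\<bar>u \<bullet> D z v - v \<bullet> D z u\<bar> \<le> 0 + t * ?C" using t by simp
  qed
  then show ?thesis by (simp add: inner_commute)
qed

section \<open>Symmetric maps with a spectral gap\<close>

locale symmetric_map =
  fixes A :: "'a::euclidean_space \<Rightarrow> 'a"
  assumes linear: "linear A"
    and symmetric: "u \<bullet> A v = A u \<bullet> v"
begin

lemma range_orthogonal_kernel:
  assumes "u \<in> range A" "A v = 0"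
  shows "u \<bullet> v = 0"
proof -
  obtain w where "u = A w" using assms(1) by auto
  then show ?thesis using symmetric[of w v] assms(2) by simp
qed

text \<open>
By symmetry, the orthogonal complement of the range is the kernel.
\<close>
lemma range_kernel_decomposition:
  obtains p q where "v = p + q" "p \<in> range A" "A q = 0"
proof -
  have sub: "subspace (range A)" using linear_subspace_image[OF linear subspace_UNIV] .
  obtain p q where p: "p \<in> range A" and q: "\<And>w. w \<in> range A \<Longrightarrow> orthogonal q w"
    and v: "v = p + q"
    using orthogonal_subspace_decomp_exists[of "range A" v] sub by (metis span_eq_iff)
  have "A q \<bullet> A q = 0" using q[of "A (A q)"] symmetric[of q "A q"] by (simp add: orthogonal_def)
  then show ?thesis using that[OF v p] by simp
qed

text \<open>
The quadratic form \<open>|A v|\<^sup>2 - s\<^sup>2 |v|\<^sup>2\<close> is nonnegative on the range and vanishes at the minimiser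
\<open>v0\<close>, so its first variation vanishes at \<open>v0\<close>. The range is invariant under \<open>A\<close>, hence the residual
\<open>u\<close> of the eigenvalue equation is itself an admissible direction, and the first variation along it is
\<open>2 |u|\<^sup>2\<close>.
\<close>
lemma rayleigh_minimiser_is_eigenvector:
  assumes v0: "v0 \<in> range A" "norm v0 = 1"
    and min: "\<And>v. v \<in> range A \<Longrightarrow> norm (A v0) * norm v \<le> norm (A v)"
  shows "A (A v0) = (norm (A v0))\<^sup>2 *\<^sub>R v0"
proof -
  define s where "s = norm (A v0)"
  define u where "u = A (A v0) - s\<^sup>2 *\<^sub>R v0"
  have sub: "subspace (range A)" using linear_subspace_image[OF linear subspace_UNIV] .
  have u: "u \<in> range A" unfolding u_def
    by (intro subspace_diff[OF sub] subspace_scale[OF sub] v0) auto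
  define Q where "Q = (\<lambda>v. A v \<bullet> A v - s\<^sup>2 * (v \<bullet> v))"
  have Q: "0 \<le> Q v" if "v \<in> range A" for v
  proof -
    have "(s * norm v)\<^sup>2 \<le> (norm (A v))\<^sup>2"
      using min[OF that] by (intro power_mono) (auto simp: s_def)
    then show ?thesis by (simp add: Q_def power_mult_distrib dot_square_norm)
  qed
  have exp: "Q (v0 + t *\<^sub>R u) = 2 * t * (u \<bullet> u) + t\<^sup>2 * Q u" for t
  proof -
    have "Q (v0 + t *\<^sub>R u) = Q v0 + 2 * t * (A u \<bullet> A v0 - s\<^sup>2 * (u \<bullet> v0)) + t\<^sup>2 * Q u"
      by (simp add: Q_def linear_add[OF linear] linear_scale[OF linear] inner_add_left inner_add_right
          algebra_simps power2_eq_square inner_commute)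
    moreover have "Q v0 = 0" using v0 by (simp add: Q_def s_def dot_square_norm)
    moreover have "A u \<bullet> A v0 = u \<bullet> A (A v0)" by (simp add: symmetric)
    ultimately show ?thesis by (simp add: u_def inner_diff_right)
  qed
  have "2 * (u \<bullet> u) \<le> 0"
  proof (rule le_if_le_add_small_multiple)
    fix t :: real assume t: "0 < t"
    have "0 \<le> Q (v0 + (- t) *\<^sub>R u)"
      by (intro Q subspace_add[OF sub] subspace_scale[OF sub] v0 u)
    then have "t * (2 * (u \<bullet> u)) \<le> t * (t * Q u)" unfolding exp by (simp add: power2_eq_square)
    then show "2 * (u \<bullet> u) \<le> 0 + t * Q u" using t by simp
  qed
  then have "u = 0" using inner_gt_zero_iff[of u] by linarith
  then show ?thesis by (simp add: u_def s_def)
qed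

text \<open>
The minimum of \<open>|A v|\<close> over unit vectors of the range is attained and positive, and a minimiser
is an eigenvector of the square of \<open>A\<close>: a bound on positive singular values is therefore
a coercivity bound on the range.
\<close>
lemma gap_on_range:
  assumes gap: "\<And>s v. 0 < s \<Longrightarrow> v \<noteq> 0 \<Longrightarrow> A (A v) = s\<^sup>2 *\<^sub>R v \<Longrightarrow> \<sigma> \<le> s"
    and v: "v \<in> range A"
  shows "\<sigma> * norm v \<le> norm (A v)"
proof (cases "v = 0")
  case True then show ?thesis by simp
next
  case False
  have sub: "subspace (range A)" using linear_subspace_image[OF linear subspace_UNIV] .
  let ?S = "sphere 0 1 \<inter> range A"
  have "compact ?S" by (intro compact_Int_closed closed_subspace sub) auto
  moreover have "(1 / norm v) *\<^sub>R v \<in> ?S" using False by (auto intro: subspace_scale[OF sub v])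
  moreover have "continuous_on ?S (\<lambda>v. norm (A v))"
    by (intro continuous_on_norm linear_continuous_on linear_conv_bounded_linear[THEN iffD1] linear)
  ultimately obtain v0 where v0: "v0 \<in> ?S" and min: "\<And>w. w \<in> ?S \<Longrightarrow> norm (A v0) \<le> norm (A w)"
    using continuous_attains_inf[of ?S "\<lambda>v. norm (A v)"] by blast
  have min': "norm (A v0) * norm w \<le> norm (A w)" if w: "w \<in> range A" for w
  proof (cases "w = 0")
    case True then show ?thesis by (simp add: linear_0[OF linear])
  next
    case False
    then have "(1 / norm w) *\<^sub>R w \<in> ?S" by (auto intro: subspace_scale[OF sub w])
    from min[OF this] False show ?thesis by (simp add: linear_scale[OF linear] field_simps)
  qed
  have "A v0 \<noteq> 0" using v0 range_orthogonal_kernel[of v0 v0] by auto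
  moreover have "A (A v0) = (norm (A v0))\<^sup>2 *\<^sub>R v0"
    using v0 min' by (intro rayleigh_minimiser_is_eigenvector) auto
  moreover have "v0 \<noteq> 0" using v0 by auto
  ultimately have "\<sigma> \<le> norm (A v0)" by (intro gap[of _ v0]) auto
  then have "\<sigma> * norm v \<le> norm (A v0) * norm v" by (intro mult_right_mono) auto
  with min'[OF v] show ?thesis by simp
qed

end

locale gapped_symmetric_map = symmetric_map A for A :: "'a::euclidean_space \<Rightarrow> 'a" +
  fixes \<sigma> :: real
  assumes sigma_pos: "0 < \<sigma>"
    and gap: "v \<in> range A \<Longrightarrow> \<sigma> * norm v \<le> norm (A v)"
begin

text \<open>
Split \<open>a\<close> into its parts in the range and the kernel; the range part is cancelled by
\<open>A w\<close> for a unique \<open>w\<close> in the range, and the kernel part is the residual. Both bounds are Pythagoras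
together with the gap.
\<close>
lemma min_norm_solution:
  obtains w where "w \<in> range A" "A (a + A w) = 0" "\<sigma> * norm w \<le> norm a" "norm (a + A w) \<le> norm a"
proof -
  obtain p q where a: "a = p + q" and p: "p \<in> range A" and q: "A q = 0"
    by (rule range_kernel_decomposition)
  obtain u where u: "p = A u" using p by auto
  obtain p' q' where u': "u = p' + q'" and p': "p' \<in> range A" and q': "A q' = 0"
    by (rule range_kernel_decomposition)
  have Ap': "A p' = p" using u u' q' linear_add[OF linear] by simp
  have sub: "subspace (range A)" using linear_subspace_image[OF linear subspace_UNIV] .
  have aw: "a + A (- p') = q" using a Ap' linear_neg[OF linear] by simp
  have orth: "orthogonal p q" using range_orthogonal_kernel[OF p q] by (simp add: orthogonal_def)
  have "(norm a)\<^sup>2 = (norm p)\<^sup>2 + (norm q)\<^sup>2" unfolding a by (rule norm_add_Pythagorean[OF orth])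
  then have "norm p \<le> norm a" "norm q \<le> norm a" by (auto intro: power2_le_imp_le)
  then show ?thesis
    using that[of "- p'"] aw q gap[OF p'] Ap' subspace_neg[OF sub p'] by auto
qed

end

text \<open>
Only the component of \<open>v\<close> in the range of \<open>A\<close> matters, and it is short:
\<open>A\<close> expands it by at least \<open>\<sigma>\<close>, yet \<open>A v = (A - B) v\<close> is small.
\<close>
lemma range_kernel_almost_orthogonal:
  assumes "gapped_symmetric_map A \<sigma>" "gapped_symmetric_map B \<sigma>"
    and close: "\<And>v. norm (A v - B v) \<le> \<delta> * norm v"
    and u: "u \<in> range A" and v: "B v = 0"
  shows "\<sigma> * \<bar>u \<bullet> v\<bar> \<le> \<delta> * norm u * norm v"
proof -
  interpret A: gapped_symmetric_map A \<sigma> by fact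
  obtain p q where pq: "v = p + q" and p: "p \<in> range A" and q: "A q = 0"
    by (rule A.range_kernel_decomposition)
  have "\<sigma> * norm p \<le> norm (A p)" by (rule A.gap[OF p])
  also have "A p = A v - B v" using pq q v linear_add[OF A.linear] by simp
  also have "norm \<dots> \<le> \<delta> * norm v" by (rule close)
  finally have np: "\<sigma> * norm p \<le> \<delta> * norm v" .
  have "u \<bullet> v = u \<bullet> p" using pq A.range_orthogonal_kernel[OF u q] by (simp add: inner_add_right)
  then have "\<sigma> * \<bar>u \<bullet> v\<bar> \<le> \<sigma> * (norm u * norm p)"
    using A.sigma_pos Cauchy_Schwarz_ineq2[of u p] by simp
  also have "\<dots> \<le> norm u * (\<delta> * norm v)"
    using mult_left_mono[OF np norm_ge_zero[of u]] by (simp add: mult_ac)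
  finally show ?thesis by (simp add: mult_ac)
qed

text \<open>
Split the difference of the solutions along the range and the kernel of \<open>B\<close>. The kernel
part is a kernel part of \<open>wA\<close> alone, and \<open>wA\<close> is in the range of \<open>A\<close>, which is almost orthogonal
to it. The range part is controlled by its image under \<open>B\<close>, on which the two defining
equations can be compared; there the residual \<open>a + A wA\<close>, a kernel vector of \<open>A\<close>, is
again almost orthogonal to the range of \<open>B\<close>.
\<close>
lemma min_norm_solution_lipschitz:
  assumes A: "gapped_symmetric_map A \<sigma>" and B: "gapped_symmetric_map B \<sigma>"
    and close: "\<And>v. norm (A v - B v) \<le> \<delta> * norm v"
    and wA: "wA \<in> range A" "A (a + A wA) = 0" "norm (a + A wA) \<le> r" "norm wA \<le> W"
    and wB: "wB \<in> range B" "B (b + B wB) = 0"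
  shows "norm (wA - wB) \<le> (\<delta> * (2 * W + r / \<sigma>) + norm (a - b)) / \<sigma>"
proof -
  interpret A: gapped_symmetric_map A \<sigma> by fact
  interpret B: gapped_symmetric_map B \<sigma> by fact
  have close': "norm (B v - A v) \<le> \<delta> * norm v" for v using close[of v] by (simp add: norm_minus_commute)
  have \<delta>: "0 \<le> \<delta>"
  proof -
    obtain b :: 'a where "norm b = 1" using vector_choose_size[of 1] by auto
    then show ?thesis using order_trans[OF norm_ge_zero close[of b]] by simp
  qed
  obtain p q where pq: "wA - wB = p + q" and p: "p \<in> range B" and q: "B q = 0"
    by (rule B.range_kernel_decomposition)
  \<comment> \<open>the kernel part only sees \<open>wA\<close>\<close>
  have "q \<bullet> q = wA \<bullet> q"
  proof -
    have "(wA - wB) \<bullet> q = p \<bullet> q + q \<bullet> q" by (simp add: pq inner_add_left)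
    then show ?thesis
      using B.range_orthogonal_kernel[OF p q] B.range_orthogonal_kernel[OF wB(1) q]
      by (simp add: inner_diff_left)
  qed
  then have "norm q * norm q = \<bar>wA \<bullet> q\<bar>"
    by (metis abs_of_nonneg inner_ge_zero power2_eq_square power2_norm_eq_inner)
  then have "\<sigma> * (norm q * norm q) \<le> \<delta> * norm wA * norm q"
    using range_kernel_almost_orthogonal[OF A B close wA(1) q] by simp
  then have q1: "\<sigma> * norm q \<le> \<delta> * norm wA" by (cases "q = 0") (auto simp: \<delta> mult.assoc[symmetric])
  \<comment> \<open>\<open>B\<close> maps the range part injectively, so its image is estimated instead\<close>
  define c where "c = B p"
  have c: "c \<in> range B" "c = B wA - B wB"
    using pq q linear_add[OF B.linear, of p q] linear_diff[OF B.linear, of wA wB]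
    unfolding c_def by (blast, simp)
  have "c \<bullet> c = c \<bullet> (B wA - A wA) + c \<bullet> (a + A wA) + c \<bullet> (b - a) - c \<bullet> (b + B wB)"
    by (simp add: c(2) inner_add_right inner_diff_right)
  also have "c \<bullet> (b + B wB) = 0" by (rule B.range_orthogonal_kernel[OF c(1) wB(2)])
  finally have "norm c * norm c \<le> \<bar>c \<bullet> (B wA - A wA)\<bar> + \<bar>c \<bullet> (a + A wA)\<bar> + \<bar>c \<bullet> (b - a)\<bar>"
    by (simp flip: power2_eq_square add: power2_norm_eq_inner)
  also have "\<bar>c \<bullet> (B wA - A wA)\<bar> \<le> norm c * (\<delta> * norm wA)"
    by (rule order_trans[OF Cauchy_Schwarz_ineq2 mult_left_mono[OF close']]) simp
  also have "\<bar>c \<bullet> (b - a)\<bar> \<le> norm c * norm (a - b)"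
    by (metis Cauchy_Schwarz_ineq2 norm_minus_commute)
  also have "\<bar>c \<bullet> (a + A wA)\<bar> \<le> norm c * (\<delta> * norm (a + A wA) / \<sigma>)"
    using range_kernel_almost_orthogonal[OF B A close' c(1) wA(2)] B.sigma_pos
    by (simp add: field_simps)
  finally have "norm c * norm c \<le> norm c * (\<delta> * norm wA + \<delta> * norm (a + A wA) / \<sigma> + norm (a - b))"
    by (simp add: distrib_left)
  then have "norm c \<le> \<delta> * norm wA + \<delta> * norm (a + A wA) / \<sigma> + norm (a - b)"
    using \<delta> B.sigma_pos by (cases "c = 0") auto
  with B.gap[OF p] have p1: "\<sigma> * norm p \<le> \<delta> * norm wA + \<delta> * norm (a + A wA) / \<sigma> + norm (a - b)"
    by (simp add: c_def)
  have "\<sigma> * norm (wA - wB) \<le> \<sigma> * norm p + \<sigma> * norm q"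
    unfolding pq using B.sigma_pos norm_triangle_ineq[of p q] by (simp add: distrib_left[symmetric])
  also have "\<dots> \<le> \<delta> * norm wA + \<delta> * norm (a + A wA) / \<sigma> + norm (a - b) + \<delta> * norm wA"
    using p1 q1 by simp
  also have "\<dots> \<le> \<delta> * W + \<delta> * r / \<sigma> + norm (a - b) + \<delta> * W"
    using wA \<delta> B.sigma_pos by (intro add_mono divide_right_mono mult_left_mono) auto
  finally show ?thesis using B.sigma_pos by (simp add: field_simps)
qed

text \<open>
With this step length the quadratic term of the expansion absorbs half of the gain
\<open>2 |A e|\<^sup>2 / L\<^sup>2\<close>, and the gap turns the other half into a contraction.
\<close>
lemma (in gapped_symmetric_map) gradient_step_contracts:
  assumes bound: "\<And>v. norm (A v) \<le> L * norm v" and L: "0 < L" and e: "e \<in> range A"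
  shows "(norm (e - (1 / L\<^sup>2) *\<^sub>R A (A e)))\<^sup>2 \<le> (1 - \<sigma>\<^sup>2 / L\<^sup>2) * (norm e)\<^sup>2"
proof -
  let ?\<rho> = "1 / L\<^sup>2"
  have "(norm (e - ?\<rho> *\<^sub>R A (A e)))\<^sup>2
      = (norm e)\<^sup>2 - 2 * ?\<rho> * (e \<bullet> A (A e)) + ?\<rho>\<^sup>2 * (norm (A (A e)))\<^sup>2"
    unfolding power2_norm_eq_inner
    by (simp add: inner_diff_left inner_diff_right inner_commute power2_eq_square)
  also have "e \<bullet> A (A e) = (norm (A e))\<^sup>2" by (simp add: symmetric power2_norm_eq_inner)
  also have "?\<rho>\<^sup>2 * (norm (A (A e)))\<^sup>2 \<le> ?\<rho>\<^sup>2 * (L * norm (A e))\<^sup>2"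
    by (intro mult_left_mono power_mono bound) auto
  also have "\<dots> = ?\<rho> * (norm (A e))\<^sup>2" using L by (simp add: power2_eq_square)
  also have "(norm e)\<^sup>2 - 2 * ?\<rho> * (norm (A e))\<^sup>2 + ?\<rho> * (norm (A e))\<^sup>2 = (norm e)\<^sup>2 - ?\<rho> * (norm (A e))\<^sup>2"
    by simp
  also have "\<dots> \<le> (norm e)\<^sup>2 - ?\<rho> * (\<sigma> * norm e)\<^sup>2"
    using sigma_pos by (intro diff_left_mono mult_left_mono power_mono gap e) auto
  finally show ?thesis by (simp add: power_mult_distrib algebra_simps)
qed

text \<open>
Starting from 0 keeps all iterates in the range of \<open>A\<close>, where the gap is effective; this is why
the limit is the least-norm solution.
\<close>
lemma (in gapped_symmetric_map) gradient_iteration_converges: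
  assumes bound: "\<And>v. norm (A v) \<le> L * norm v" and L: "\<sigma> \<le> L"
    and w: "w \<in> range A" "A (a + A w) = 0"
  shows "(norm (((\<lambda>v. v - (1 / L\<^sup>2) *\<^sub>R A (a + A v)) ^^ T) 0 - w))\<^sup>2
         \<le> (1 - \<sigma>\<^sup>2 / L\<^sup>2) ^ T * (norm w)\<^sup>2"
proof -
  let ?step = "\<lambda>v. v - (1 / L\<^sup>2) *\<^sub>R A (a + A v)"
  have sub: "subspace (range A)" using linear_subspace_image[OF linear subspace_UNIV] .
  have L0: "0 < L" using L sigma_pos by simp
  have q: "0 \<le> 1 - \<sigma>\<^sup>2 / L\<^sup>2" using L sigma_pos by (simp add: power_mono)
  have "(?step ^^ T) 0 \<in> range A \<and> (norm ((?step ^^ T) 0 - w))\<^sup>2 \<le> (1 - \<sigma>\<^sup>2 / L\<^sup>2) ^ T * (norm w)\<^sup>2"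
  proof (induction T)
    case 0 then show ?case using subspace_0[OF sub] by simp
  next
    case (Suc T)
    let ?v = "(?step ^^ T) 0"
    have "A (a + A ?v) = A (a + A w + A (?v - w))" by (simp add: linear_diff[OF linear])
    also have "\<dots> = A (A (?v - w))" using w(2) by (simp add: linear_add[OF linear])
    finally have eq: "?step ?v - w = (?v - w) - (1 / L\<^sup>2) *\<^sub>R A (A (?v - w))" by simp
    have "(norm (?step ?v - w))\<^sup>2 \<le> (1 - \<sigma>\<^sup>2 / L\<^sup>2) * (norm (?v - w))\<^sup>2"
      unfolding eq using Suc w(1) by (intro gradient_step_contracts bound L0 subspace_diff[OF sub]) auto
    also have "\<dots> \<le> (1 - \<sigma>\<^sup>2 / L\<^sup>2) * ((1 - \<sigma>\<^sup>2 / L\<^sup>2) ^ T * (norm w)\<^sup>2)"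
      using Suc q by (intro mult_left_mono) auto
    finally have "(norm (?step ?v - w))\<^sup>2 \<le> (1 - \<sigma>\<^sup>2 / L\<^sup>2) ^ Suc T * (norm w)\<^sup>2" by (simp add: mult_ac)
    moreover have "?step ?v \<in> range A"
      using Suc by (intro subspace_diff[OF sub] subspace_scale[OF sub]) auto
    ultimately show ?case by simp
  qed
  then show ?thesis by simp
qed

section \<open>Bilevel problems with a PL lower level\<close>

text \<open>
Up to a change of constants, one \<open>L \<ge> 1\<close> serves as every Lipschitz constant and \<open>\<mu>\<close> and
\<open>\<sigma>\<close> are at most 1. The function \<open>gs\<close> is the lower-level value and \<open>fs\<close> bounds \<open>f\<close> from below on
the lower-level solutions. Working with full derivatives \<open>F\<close>, \<open>G\<close>, \<open>D\<close> makes every Taylor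
expansion an instance of \<open>linearization_error\<close>; partial gradients and Hessian blocks are projections.
\<close>
locale bilevel_pl =
  fixes f g :: "'a::euclidean_space \<times> 'b::euclidean_space \<Rightarrow> real"
    and F G :: "'a \<times> 'b \<Rightarrow> 'a \<times> 'b"
    and D :: "'a \<times> 'b \<Rightarrow> ('a \<times> 'b) \<Rightarrow>\<^sub>L ('a \<times> 'b)"
    and gs :: "'a \<Rightarrow> real"
    and L \<mu> \<sigma> fs :: real
  assumes f_grad: "GDERIV f z :> F z"
    and g_grad: "GDERIV g z :> G z"
    and G_deriv: "(G has_derivative blinfun_apply (D z)) (at z)"
    and F_lip: "norm (F z - F z') \<le> L * norm (z - z')"
    and G_lip: "norm (G z - G z') \<le> L * norm (z - z')"
    and D_lip: "norm (D z - D z') \<le> L * norm (z - z')"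
    and f_lip_y: "\<bar>f (x, y) - f (x, y')\<bar> \<le> L * norm (y - y')"
    and L_ge_1: "1 \<le> L"
    and gs_le: "gs x \<le> g (x, y)"
    and gs_attained: "\<exists>y. g (x, y) = gs x"
    and PL: "2 * \<mu> * (g (x, y) - gs x) \<le> (norm (snd (G (x, y))))\<^sup>2"
    and mu: "0 < \<mu>" "\<mu> \<le> 1"
    and sigma: "0 < \<sigma>" "\<sigma> \<le> 1"
    and spectral: "0 < s \<Longrightarrow> v \<noteq> 0 \<Longrightarrow> snd (D z (0, snd (D z (0, v)))) = s\<^sup>2 *\<^sub>R v \<Longrightarrow> \<sigma> \<le> s"
    and f_lower: "g (x, y) = gs x \<Longrightarrow> fs \<le> f (x, y)"
begin

text \<open>
\<open>H\<close> and \<open>J\<close> are the \<open>yy\<close>- and \<open>xy\<close>-blocks of the Hessian of \<open>g\<close>, as linear maps.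
\<close>
definition H :: "'a \<times> 'b \<Rightarrow> 'b \<Rightarrow> 'b" where
  "H z v = snd (D z (0, v))"

definition J :: "'a \<times> 'b \<Rightarrow> 'b \<Rightarrow> 'a" where
  "J z w = fst (D z (0, w))"

definition R :: "'a \<times> 'b \<Rightarrow> real" where
  "R z = g z - gs (fst z)"

lemma L_pos: "0 < L" using L_ge_1 by simp

lemma R_nonneg: "0 \<le> R z"
  using gs_le[of "fst z" "snd z"] by (simp add: R_def)

lemma f_taylor: "\<bar>f (z + v) - f z - F z \<bullet> v\<bar> \<le> L * (norm v)\<^sup>2"
  by (rule linearization_error_gradient[OF f_grad F_lip])

lemma g_taylor: "\<bar>g (z + v) - g z - G z \<bullet> v\<bar> \<le> L * (norm v)\<^sup>2"
  by (rule linearization_error_gradient[OF g_grad G_lip])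

lemma G_taylor: "norm (G (z + v) - G z - D z v) \<le> L * (norm v)\<^sup>2"
  by (rule linearization_error[OF G_deriv D_lip])

lemma grad_y_taylor: "norm (snd (G (z + v)) - snd (G z) - snd (D z v)) \<le> L * (norm v)\<^sup>2"
  using order_trans[OF norm_snd G_taylor, of z v] by simp

lemma D_bound: "norm (D z v) \<le> L * norm v"
  by (rule norm_derivative_le_lipschitz[OF G_deriv D_lip G_lip])

lemma D_symmetric: "u \<bullet> D z v = D z u \<bullet> v"
  by (rule second_derivative_symmetric[OF g_grad G_deriv D_lip])

lemma H_bound: "norm (H z v) \<le> L * norm v"
  unfolding H_def using order_trans[OF norm_snd D_bound[of z "(0, v)"]] by simp

lemma J_bound: "norm (J z v) \<le> L * norm v"
  unfolding J_def using order_trans[OF norm_fst D_bound[of z "(0, v)"]] by simp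

lemma D_diff: "norm (D z v - D z' v) \<le> L * norm (z - z') * norm v"
proof -
  have "norm (D z v - D z' v) \<le> norm (D z - D z') * norm v"
    using norm_blinfun[of "D z - D z'" v] by (simp add: blinfun.diff_left)
  also have "\<dots> \<le> L * norm (z - z') * norm v" by (intro mult_right_mono D_lip) simp
  finally show ?thesis .
qed

lemma H_diff: "norm (H z v - H z' v) \<le> L * norm (z - z') * norm v"
  using order_trans[OF norm_snd D_diff[of z "(0, v)" z']] by (simp add: H_def)

lemma J_diff: "norm (J z v - J z' v) \<le> L * norm (z - z') * norm v"
  using order_trans[OF norm_fst D_diff[of z "(0, v)" z']] by (simp add: J_def)

lemma H_linear: "linear (H z)"
proof (rule linearI)
  show "H z (u + v) = H z u + H z v" for u v
    using blinfun.add_right[of "D z" "(0, u)" "(0, v)"] by (simp add: H_def)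
  show "H z (c *\<^sub>R v) = c *\<^sub>R H z v" for c v
    using blinfun.scaleR_right[of "D z" c "(0, v)"] by (simp add: H_def)
qed

lemma J_linear: "linear (J z)"
proof (rule linearI)
  show "J z (u + v) = J z u + J z v" for u v
    using blinfun.add_right[of "D z" "(0, u)" "(0, v)"] by (simp add: J_def)
  show "J z (c *\<^sub>R v) = c *\<^sub>R J z v" for c v
    using blinfun.scaleR_right[of "D z" c "(0, v)"] by (simp add: J_def)
qed

lemma J_transpose: "J z w \<bullet> u = w \<bullet> snd (D z (u, 0))"
  using D_symmetric[of "(0, w)" z "(u, 0)"] by (simp add: J_def inner_prod_def)

lemma H_symmetric: "u \<bullet> H z v = H z u \<bullet> v"
  using D_symmetric[of "(0, u)" z "(0, v)"] by (simp add: H_def inner_prod_def)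

sublocale H: symmetric_map "H z" for z
  by (rule symmetric_map.intro[OF H_linear H_symmetric])

sublocale H: gapped_symmetric_map "H z" \<sigma> for z
proof
  show "0 < \<sigma>" by (fact sigma)
  show "\<sigma> * norm v \<le> norm (H z v)" if "v \<in> range (H z)" for v
  proof (rule H.gap_on_range[OF _ that])
    show "\<sigma> \<le> s" if "0 < s" "v \<noteq> 0" "H z (H z v) = s\<^sup>2 *\<^sub>R v" for s v
      using spectral[OF that(1,2)] that(3) by (simp add: H_def)
  qed
qed

text \<open>
The Lipschitz continuity of \<open>f\<close> in \<open>y\<close>, tested in the direction of its own partial gradient.
\<close>
lemma grad_y_f_bound: "norm (snd (F z)) \<le> L"
proof -
  let ?s = "snd (F z)"
  have "norm ?s * norm ?s \<le> L * norm ?s"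
  proof (rule le_if_le_add_small_multiple)
    fix t :: real assume t: "0 < t"
    have "F z \<bullet> (0, t *\<^sub>R ?s) \<le> f (z + (0, t *\<^sub>R ?s)) - f z + L * (norm (0::'a, t *\<^sub>R ?s))\<^sup>2"
      using f_taylor[of z "(0, t *\<^sub>R ?s)"] by linarith
    also have "f (z + (0, t *\<^sub>R ?s)) - f z \<le> L * norm (t *\<^sub>R ?s)"
      using f_lip_y[of "fst z" "snd z + t *\<^sub>R ?s" "snd z"] by (cases z) auto
    finally have "t * (norm ?s * norm ?s) \<le> t * (L * norm ?s + t * (L * (norm ?s)\<^sup>2))"
      using t by (simp add: inner_prod_def power2_eq_square algebra_simps norm_Pair
          flip: power2_norm_eq_inner)
    then show "norm ?s * norm ?s \<le> L * norm ?s + t * (L * (norm ?s)\<^sup>2)" using t by simp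
  qed
  then show ?thesis using L_pos by (cases "?s = 0") auto
qed

section \<open>Consequences of the PL inequality\<close>

text \<open>
The descent lemma; the step length minimises the upper bound \<open>(L \<beta>\<^sup>2 - \<beta>) |grad_y g|\<^sup>2\<close> for the change.
\<close>
lemma R_gradient_step:
  "R (x, y - (1 / (2 * L)) *\<^sub>R snd (G (x, y))) \<le> R (x, y) - (1 / (4 * L)) * (norm (snd (G (x, y))))\<^sup>2"
proof -
  let ?s = "snd (G (x, y))" and ?v = "- (1 / (2 * L)) *\<^sub>R snd (G (x, y))"
  have "g ((x, y) + (0, ?v)) \<le> g (x, y) + G (x, y) \<bullet> (0, ?v) + L * (norm (0::'a, ?v))\<^sup>2"
    using g_taylor[of "(x, y)" "(0, ?v)"] by linarith
  also have "G (x, y) \<bullet> (0, ?v) = - (1 / (2 * L)) * (norm ?s)\<^sup>2"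
    by (simp add: inner_prod_def power2_norm_eq_inner)
  also have "L * (norm (0::'a, ?v))\<^sup>2 = (1 / (4 * L)) * (norm ?s)\<^sup>2"
    using L_pos by (simp add: norm_Pair power_mult_distrib power2_eq_square)
  finally show ?thesis using L_pos by (simp add: R_def field_simps)
qed

lemma grad_y_sq_le: "(norm (snd (G z)))\<^sup>2 \<le> 4 * L * R z"
proof -
  have "(1 / (4 * L)) * (norm (snd (G z)))\<^sup>2 \<le> R z"
    using R_gradient_step[of "fst z" "snd z"]
      R_nonneg[of "(fst z, snd z - (1 / (2 * L)) *\<^sub>R snd (G z))"] by simp
  then show ?thesis using L_pos by (simp add: field_simps)
qed

lemma grad_y_zero: "R z = 0 \<Longrightarrow> snd (G z) = 0"
  using grad_y_sq_le[of z] by simp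

lemma R_contracts: "R (x, y - (1 / (2 * L)) *\<^sub>R snd (G (x, y))) \<le> (1 - \<mu> / (2 * L)) * R (x, y)"
proof -
  have "(1 / (4 * L)) * (2 * \<mu> * R (x, y)) \<le> (1 / (4 * L)) * (norm (snd (G (x, y))))\<^sup>2"
    using PL[of x y] L_pos by (intro mult_left_mono) (auto simp: R_def)
  then show ?thesis using R_gradient_step[of x y] by (simp add: algebra_simps)
qed

text \<open>
The decrease of \<open>R\<close> is quadratic in the gradient, and by the PL inequality the gradient dominates
\<open>sqrt R\<close>. Hence the square root of \<open>R\<close> decreases at a fixed rate per unit of distance travelled.
\<close>
lemma sqrt_R_gradient_step:
  fixes x y
  defines "y' \<equiv> y - (1 / (2 * L)) *\<^sub>R snd (G (x, y))"
  shows "sqrt (\<mu> / 8) * norm (y' - y) \<le> sqrt (R (x, y)) - sqrt (R (x, y'))"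
proof -
  define s where "s = norm (snd (G (x, y)))"
  define a where "a = sqrt (R (x, y))"
  define b where "b = sqrt (R (x, y'))"
  have a2: "a\<^sup>2 = R (x, y)" and b2: "b\<^sup>2 = R (x, y')" using R_nonneg by (auto simp: a_def b_def)
  have ab: "0 \<le> a" "0 \<le> b" by (auto simp: a_def b_def R_nonneg)
  have step: "b\<^sup>2 \<le> a\<^sup>2 - (1 / (4 * L)) * s\<^sup>2"
    unfolding a2 b2 s_def y'_def by (rule R_gradient_step)
  have ny: "norm (y' - y) = s / (2 * L)" using L_pos by (simp add: y'_def s_def)
  have "0 \<le> (1 / (4 * L)) * s\<^sup>2" using L_pos by simp
  with step have "b\<^sup>2 \<le> a\<^sup>2" by linarith
  then have ba: "b \<le> a" using ab(1) by (rule power2_le_imp_le)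
  show ?thesis
  proof (cases "a = 0")
    case True
    then have "s = 0" using grad_y_zero[of "(x, y)"] a2 by (simp add: s_def)
    then show ?thesis using ny ba by (simp add: a_def b_def)
  next
    case False
    have "(sqrt (2 * \<mu>) * a)\<^sup>2 = 2 * \<mu> * R (x, y)" using mu by (simp add: power_mult_distrib a2)
    also have "\<dots> \<le> s\<^sup>2" using PL[of x y] by (simp add: R_def s_def)
    finally have "sqrt (2 * \<mu>) * a \<le> s" by (rule power2_le_imp_le) (simp add: s_def)
    then have "(1 / (4 * L)) * s * (sqrt (2 * \<mu>) * a) \<le> (1 / (4 * L)) * s * s"
      using L_pos by (intro mult_left_mono) (auto simp: s_def)
    also have "\<dots> \<le> (a - b) * (a + b)" using step by (simp add: power2_eq_square algebra_simps)
    also have "\<dots> \<le> (a - b) * (2 * a)" using ba by (intro mult_left_mono) auto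
    finally have "a * ((1 / (4 * L)) * s * sqrt (2 * \<mu>)) \<le> a * (2 * (a - b))" by (simp add: mult_ac)
    then have "(1 / (4 * L)) * s * sqrt (2 * \<mu>) \<le> 2 * (a - b)"
      by (rule mult_left_le_imp_le) (use False ab in simp)
    moreover have "sqrt (2 * \<mu>) = 4 * sqrt (\<mu> / 8)"
    proof -
      have "sqrt (2 * \<mu>) = sqrt (16 * (\<mu> / 8))" by simp
      then show ?thesis by (simp only: real_sqrt_mult) simp
    qed
    ultimately show ?thesis using L_pos unfolding ny a_def[symmetric] b_def[symmetric]
      by (simp add: field_simps)
  qed
qed

lemma g_continuous: "continuous_on S g"
proof -
  have "(g has_derivative (\<lambda>h. h \<bullet> G z)) (at z)" for z using g_grad[of z] by (simp add: gderiv_def)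
  then show ?thesis by (meson continuous_at_imp_continuous_on has_derivative_continuous)
qed

text \<open>
Minimise \<open>sqrt R + c |. - y|\<close>, with \<open>c\<close> half the rate of \<open>sqrt_R_gradient_step\<close>. A gradient
step from the minimiser would lower this function unless the gradient vanishes there, so by the PL
inequality the minimiser solves the lower-level problem; comparing its value with the one at
\<open>y\<close> bounds the distance.
\<close>
lemma error_bound:
  obtains yb where "g (x, yb) = gs x" "(norm (y - yb))\<^sup>2 \<le> 32 / \<mu> * R (x, y)"
proof -
  define c where "c = sqrt (\<mu> / 8) / 2"
  have c: "0 < c" using mu by (simp add: c_def)
  define \<phi> where "\<phi> v = sqrt (R (x, v)) + c * norm (v - y)" for v
  define r where "r = sqrt (R (x, y)) / c"
  have r: "0 \<le> r" using c R_nonneg by (simp add: r_def)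
  have "continuous_on UNIV (\<lambda>v. g (x, v))"
    by (rule continuous_on_compose2[OF g_continuous[of UNIV]]) (auto intro!: continuous_intros)
  then have "continuous_on (cball y r) \<phi>"
    unfolding \<phi>_def R_def by (auto intro!: continuous_intros elim: continuous_on_subset)
  then obtain yb where yb: "yb \<in> cball y r" and min: "\<And>v. v \<in> cball y r \<Longrightarrow> \<phi> yb \<le> \<phi> v"
    using continuous_attains_inf[of "cball y r" \<phi>] r by auto
  have \<phi>y: "\<phi> yb \<le> sqrt (R (x, y))" using min[of y] r by (simp add: \<phi>_def)
  \<comment> \<open>outside the ball the penalty alone exceeds the value at the centre, so the minimum is global\<close>
  have gmin: "\<phi> yb \<le> \<phi> v" for v
  proof (cases "v \<in> cball y r")
    case False
    then have "r < norm (v - y)" by (simp add: dist_norm norm_minus_commute)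
    then have "sqrt (R (x, y)) < c * norm (v - y)" using c by (simp add: r_def field_simps)
    also have "\<dots> \<le> \<phi> v" using R_nonneg by (simp add: \<phi>_def)
    finally show ?thesis using \<phi>y by simp
  qed (rule min)
  define y' where "y' = yb - (1 / (2 * L)) *\<^sub>R snd (G (x, yb))"
  have "\<phi> y' \<le> \<phi> yb - c * norm (y' - yb)"
  proof -
    have "c * norm (y' - y) \<le> c * norm (y' - yb) + c * norm (yb - y)"
      unfolding distrib_left[symmetric]
      by (rule mult_left_mono) (use c norm_triangle_ineq[of "y' - yb" "yb - y"] in auto)
    moreover have "2 * (c * norm (y' - yb)) \<le> sqrt (R (x, yb)) - sqrt (R (x, y'))"
      using sqrt_R_gradient_step[of yb x] by (simp add: y'_def c_def)
    ultimately show ?thesis by (simp add: \<phi>_def)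
  qed
  with gmin[of y'] have "c * norm (y' - yb) \<le> 0" by simp
  then have "y' = yb" using c by (simp add: mult_le_0_iff)
  then have "snd (G (x, yb)) = 0" using L_pos by (simp add: y'_def)
  then have "g (x, yb) \<le> gs x" using PL[of x yb] mu by (simp add: mult_le_0_iff)
  then have eq: "g (x, yb) = gs x" using gs_le[of x yb] by simp
  have "c * norm (y - yb) \<le> sqrt (R (x, y))"
    using \<phi>y eq by (simp add: \<phi>_def R_def norm_minus_commute)
  then have "(c * norm (y - yb))\<^sup>2 \<le> (sqrt (R (x, y)))\<^sup>2" using c by (intro power_mono) auto
  then have "\<mu> / 32 * (norm (y - yb))\<^sup>2 \<le> R (x, y)"
    using mu R_nonneg by (simp add: c_def power_mult_distrib power_divide)
  then have "(norm (y - yb))\<^sup>2 \<le> 32 / \<mu> * R (x, y)" using mu by (simp add: field_simps)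
  with eq show ?thesis by (rule that)
qed

text \<open>
The \<open>y\<close>-step contracts \<open>R\<close> by PL. For the change of \<open>x\<close>, compare with a lower-level solution
\<open>yb\<close> for the new point \<open>x'\<close>: the increase of \<open>R\<close> is at most a mixed second difference of \<open>g\<close>,
hence at most \<open>L |x' - x| |y - yb|\<close>, and \<open>|y - yb|\<close> is in turn \<open>O(sqrt R)\<close> at the new point.
\<close>
lemma R_change_x:
  "\<exists>C\<ge>0. \<forall>x x' y. R (x', y - (1 / (2 * L)) *\<^sub>R snd (G (x, y)))
      \<le> (1 - \<mu> / (4 * L)) * R (x, y) + C * (norm (x' - x))\<^sup>2"
proof -
  \<comment> \<open>half the contraction rate of the \<open>y\<close>-step; the other half is spent in Young's inequality\<close>
  define \<delta> where "\<delta> = \<mu> / (4 * L)"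
  have \<delta>: "0 < \<delta>" "\<delta> \<le> 1 / 4" using mu L_ge_1 by (auto simp: \<delta>_def field_simps)
  define K where "K = 8 * L\<^sup>2 / (\<delta> * \<mu>)"
  have K: "0 \<le> K" using \<delta> mu by (simp add: K_def)
  have "R (x', y - (1 / (2 * L)) *\<^sub>R snd (G (x, y))) \<le> (1 - \<delta>) * R (x, y) + 2 * K * (norm (x' - x))\<^sup>2"
    for x x' y
  proof -
    define y1 where "y1 = y - (1 / (2 * L)) *\<^sub>R snd (G (x, y))"
    obtain yb where yb: "g (x', yb) = gs x'" and eb: "(norm (y1 - yb))\<^sup>2 \<le> 32 / \<mu> * R (x', y1)"
      by (rule error_bound)
    define a where "a = norm (x' - x)"
    define b where "b = norm (y1 - yb)"
    have "norm ((g (x', y1) - g (x, y1)) - (g (x', yb) - g (x, yb))) \<le> (L * a) * norm (y1 - yb)"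
    proof (rule differentiable_bound[OF convex_UNIV])
      fix v :: 'b
      have gd: "((\<lambda>v. g (u, v)) has_derivative (\<lambda>h. h \<bullet> snd (G (u, v)))) (at v)" for u
      proof -
        have "((\<lambda>v. (u, v)) has_derivative (\<lambda>h. (0, h))) (at v)"
          by (auto intro!: derivative_eq_intros)
        from has_derivative_compose[OF this, of g "\<lambda>h. h \<bullet> G (u, v)"] g_grad[of "(u, v)"]
        show ?thesis by (simp add: gderiv_def inner_prod_def)
      qed
      show "((\<lambda>v. g (x', v) - g (x, v)) has_derivative
          (\<lambda>h. h \<bullet> snd (G (x', v)) - h \<bullet> snd (G (x, v)))) (at v within UNIV)"
        using has_derivative_diff[OF gd gd] by simp
      show "onorm (\<lambda>h. h \<bullet> snd (G (x', v)) - h \<bullet> snd (G (x, v))) \<le> L * a"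
      proof (rule onorm_le)
        fix h :: 'b
        have "norm (snd (G (x', v)) - snd (G (x, v))) \<le> L * a"
          using order_trans[OF norm_snd G_lip[of "(x', v)" "(x, v)"]] by (simp add: a_def norm_Pair)
        then have "norm h * norm (snd (G (x', v)) - snd (G (x, v))) \<le> norm h * (L * a)"
          by (rule mult_left_mono) simp
        then show "norm (h \<bullet> snd (G (x', v)) - h \<bullet> snd (G (x, v))) \<le> L * a * norm h"
          unfolding inner_diff_right[symmetric] real_norm_def
          using Cauchy_Schwarz_ineq2[of h "snd (G (x', v)) - snd (G (x, v))"] by (simp add: mult_ac)
      qed
    qed auto
    then have "R (x', y1) \<le> R (x, y1) + L * a * b"
      using gs_le[of x yb] yb by (simp add: R_def b_def abs_le_iff)
    also have "R (x, y1) \<le> (1 - 2 * \<delta>) * R (x, y)"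
      using R_contracts[of x y] by (simp add: y1_def \<delta>_def)
    also have "L * a * b \<le> \<delta> * R (x', y1) + K * a\<^sup>2"
    proof -
      \<comment> \<open>Young's inequality, weighted so that the error bound turns \<open>k b\<^sup>2 / 2\<close> into \<open>\<delta> R\<close>\<close>
      define k where "k = \<delta> * \<mu> / 16"
      have k: "0 < k" using \<delta> mu by (simp add: k_def)
      have "0 \<le> (L * a - k * b)\<^sup>2" by simp
      then have "2 * k * (L * a * b) \<le> k\<^sup>2 * b\<^sup>2 + L\<^sup>2 * a\<^sup>2"
        by (simp add: power2_diff power_mult_distrib algebra_simps)
      then have "L * a * b \<le> k / 2 * b\<^sup>2 + L\<^sup>2 / (2 * k) * a\<^sup>2"
        using k by (simp add: field_simps power2_eq_square)
      moreover have "k / 2 * b\<^sup>2 \<le> k / 2 * (32 / \<mu> * R (x', y1))"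
        using eb k by (intro mult_left_mono) (auto simp: b_def)
      moreover have "k / 2 * (32 / \<mu> * R (x', y1)) = \<delta> * R (x', y1)" using mu by (simp add: k_def)
      moreover have "L\<^sup>2 / (2 * k) = K" by (simp add: K_def k_def)
      ultimately show ?thesis by simp
    qed
    finally have *: "(1 - \<delta>) * R (x', y1) \<le> (1 - 2 * \<delta>) * R (x, y) + K * a\<^sup>2"
      by (simp add: algebra_simps)
    \<comment> \<open>this lets the factor \<open>1 - \<delta>\<close> on the left cancel\<close>
    have "(1 - 2 * \<delta>) * R (x, y) \<le> (1 - \<delta>)\<^sup>2 * R (x, y)"
      using R_nonneg by (intro mult_right_mono) (auto simp: power2_eq_square algebra_simps)
    moreover have "1 * (K * a\<^sup>2) \<le> ((1 - \<delta>) * 2) * (K * a\<^sup>2)"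
      using K \<delta> by (intro mult_right_mono) auto
    ultimately have "(1 - \<delta>) * R (x', y1) \<le> (1 - \<delta>) * ((1 - \<delta>) * R (x, y) + 2 * K * a\<^sup>2)"
      using * by (simp add: power2_eq_square distrib_left mult_ac)
    then show ?thesis using \<delta> by (simp add: y1_def a_def)
  qed
  then show ?thesis using K unfolding \<delta>_def by (intro exI[of _ "2 * K"]) auto
qed

section \<open>The minimum-norm multiplier and the Lyapunov function\<close>

text \<open>
The first two conditions determine \<open>w\<close>; the bounds are carried along because the existence
proof gives them.
\<close>
definition wstar :: "'a \<times> 'b \<Rightarrow> 'b" where
  "wstar z = (SOME w. w \<in> range (H z) \<and> H z (snd (F z) + H z w) = 0 \<and>
     \<sigma> * norm w \<le> norm (snd (F z)) \<and> norm (snd (F z) + H z w) \<le> norm (snd (F z)))"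

lemma wstar_exists:
  "wstar z \<in> range (H z) \<and> H z (snd (F z) + H z (wstar z)) = 0 \<and>
     \<sigma> * norm (wstar z) \<le> norm (snd (F z)) \<and> norm (snd (F z) + H z (wstar z)) \<le> norm (snd (F z))"
  unfolding wstar_def by (rule someI_ex) (metis H.min_norm_solution)

lemma wstar_range: "wstar z \<in> range (H z)" using wstar_exists by blast

lemma wstar_solves: "H z (snd (F z) + H z (wstar z)) = 0" using wstar_exists by blast

lemma wstar_bound: "norm (wstar z) \<le> L / \<sigma>"
proof -
  have "\<sigma> * norm (wstar z) \<le> L"
    using wstar_exists[of z] grad_y_f_bound[of z] by linarith
  then show ?thesis using sigma by (simp add: field_simps)
qed

lemma wstar_residual_bound: "norm (snd (F z) + H z (wstar z)) \<le> L"
  using wstar_exists[of z] grad_y_f_bound[of z] by linarith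

definition Lw :: real where
  "Lw = (3 * L\<^sup>2 / \<sigma> + L) / \<sigma>"

lemma Lw_nonneg: "0 \<le> Lw"
  using L_pos sigma by (simp add: Lw_def)

lemma wstar_lipschitz: "norm (wstar z - wstar z') \<le> Lw * norm (z - z')"
proof -
  have "norm (wstar z - wstar z')
      \<le> (L * norm (z - z') * (2 * (L / \<sigma>) + L / \<sigma>) + norm (snd (F z) - snd (F z'))) / \<sigma>"
    by (rule min_norm_solution_lipschitz[OF H.gapped_symmetric_map_axioms H.gapped_symmetric_map_axioms
          H_diff wstar_range wstar_solves wstar_residual_bound wstar_bound wstar_range wstar_solves])
  also have "\<dots> \<le> (L * norm (z - z') * (2 * (L / \<sigma>) + L / \<sigma>) + L * norm (z - z')) / \<sigma>"
    using order_trans[OF norm_snd F_lip[of z z']] sigma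
    by (intro divide_right_mono add_left_mono) auto
  also have "\<dots> = Lw * norm (z - z')"
    using sigma by (simp add: Lw_def field_simps power2_eq_square)
  finally show ?thesis .
qed

text \<open>
The Lagrangian of minimising \<open>f\<close> subject to \<open>grad_y g = 0\<close>, with the least-norm multiplier.
\<close>
definition \<Phi> :: "'a \<times> 'b \<Rightarrow> real" where
  "\<Phi> z = f z + wstar z \<bullet> snd (G z)"

text \<open>
The partial gradient in \<open>x\<close> of the Lagrangian with the multiplier frozen.
\<close>
definition hypergrad :: "'a \<times> 'b \<Rightarrow> 'a" where
  "hypergrad z = fst (F z) + J z (wstar z)"

text \<open>
Expand \<open>grad_y g\<close> around \<open>y\<close> at a lower-level solution, where it vanishes. The linear term lies in the range of \<open>H\<close> and is
orthogonal to \<open>r\<close>, and the remainder is quadratic in the distance, that is, \<open>O(R)\<close>.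
\<close>
lemma kernel_part_of_grad_y:
  assumes "H (x, y) r = 0" "norm r \<le> L"
  shows "\<bar>r \<bullet> snd (G (x, y))\<bar> \<le> 32 * L\<^sup>2 / \<mu> * R (x, y)"
proof -
  obtain yb where yb: "g (x, yb) = gs x" and eb: "(norm (y - yb))\<^sup>2 \<le> 32 / \<mu> * R (x, y)"
    by (rule error_bound)
  have "snd (G (x, yb)) = 0" using yb by (intro grad_y_zero) (simp add: R_def)
  then have "norm (snd (G (x, y)) + H (x, y) (yb - y)) \<le> L * (norm (y - yb))\<^sup>2"
    using grad_y_taylor[of "(x, y)" "(0, yb - y)"] norm_minus_cancel[of "snd (G (x, y)) + H (x, y) (yb - y)"]
    by (simp add: H_def norm_minus_commute norm_Pair)
  also have "\<dots> \<le> L * (32 / \<mu> * R (x, y))" using eb L_pos by (intro mult_left_mono) auto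
  finally have err: "norm (snd (G (x, y)) + H (x, y) (yb - y)) \<le> L * (32 / \<mu> * R (x, y))" .
  have "r \<bullet> snd (G (x, y)) = r \<bullet> (snd (G (x, y)) + H (x, y) (yb - y))"
    using H_symmetric[of r "(x, y)" "yb - y"] assms(1) by (simp add: inner_add_right)
  then have "\<bar>r \<bullet> snd (G (x, y))\<bar> \<le> norm r * norm (snd (G (x, y)) + H (x, y) (yb - y))"
    using Cauchy_Schwarz_ineq2 by metis
  also have "\<dots> \<le> L * (L * (32 / \<mu> * R (x, y)))"
    using assms(2) err L_pos by (intro mult_mono) auto
  finally show ?thesis by (simp add: power2_eq_square mult_ac)
qed

text \<open>
The first-order effect of the \<open>y\<close>-step is an inner product of \<open>grad_y g\<close> with a vector of the
kernel of \<open>H\<close>, so \<open>kernel_part_of_grad_y\<close> applies. All other terms contain two factors of size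
\<open>O(sqrt R)\<close>.
\<close>
lemma \<Phi>_change_y:
  "\<exists>C\<ge>0. \<forall>x y. \<Phi> (x, y - (1 / (2 * L)) *\<^sub>R snd (G (x, y))) - \<Phi> (x, y) \<le> C * R (x, y)"
proof -
  define C where "C = 32 * L\<^sup>2 / \<mu> + 4 * L\<^sup>2 * (1 + L / \<sigma>) + 4 * L * Lw"
  have C: "0 \<le> C" using L_pos mu sigma Lw_nonneg by (simp add: C_def)
  have "\<Phi> (x, y - (1 / (2 * L)) *\<^sub>R snd (G (x, y))) - \<Phi> (x, y) \<le> C * R (x, y)" for x y
  proof -
    define \<beta> where "\<beta> = 1 / (2 * L)"
    have \<beta>: "0 < \<beta>" "\<beta> \<le> 1" using L_ge_1 by (auto simp: \<beta>_def)
    define z where "z = (x, y)"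
    define s where "s = snd (G z)"
    define v :: "'a \<times> 'b" where "v = (0, - \<beta> *\<^sub>R s)"
    define z' where "z' = z + v"
    define s' where "s' = snd (G z')"
    define w where "w = wstar z"
    have z': "z' = (x, y - \<beta> *\<^sub>R s)" by (simp add: z'_def z_def v_def)
    have nv: "norm v = \<beta> * norm s" using \<beta> by (simp add: v_def norm_Pair)
    have s2: "(norm s)\<^sup>2 \<le> 4 * L * R z" unfolding s_def by (rule grad_y_sq_le)
    have Rz': "R z' \<le> R z"
      using R_gradient_step[of x y] L_pos by (simp add: z' z_def s_def \<beta>_def) (smt (verit) divide_nonneg_pos zero_le_power2)
    have s'2: "(norm s')\<^sup>2 \<le> 4 * L * R z"
      using order_trans[OF grad_y_sq_le[of z'] mult_left_mono[OF Rz', of "4 * L"]] L_pos by (simp add: s'_def)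
    have v2: "(norm v)\<^sup>2 \<le> 4 * L * R z"
    proof -
      have "\<beta>\<^sup>2 * (norm s)\<^sup>2 \<le> 1 * (norm s)\<^sup>2" using \<beta> by (intro mult_right_mono) (auto simp: power_le_one)
      then show ?thesis using s2 by (simp add: nv power_mult_distrib)
    qed
    have 1: "f z' - f z \<le> snd (F z) \<bullet> (- \<beta> *\<^sub>R s) + L * (4 * L * R z)"
    proof -
      have "F z \<bullet> v = snd (F z) \<bullet> (- \<beta> *\<^sub>R s)" by (simp add: v_def inner_prod_def)
      moreover have "L * (norm v)\<^sup>2 \<le> L * (4 * L * R z)" using v2 L_pos by (intro mult_left_mono) auto
      ultimately show ?thesis using f_taylor[of z v] by (simp add: z'_def)
    qed
    have 2: "w \<bullet> (s' - s) \<le> H z w \<bullet> (- \<beta> *\<^sub>R s) + L / \<sigma> * (L * (4 * L * R z))"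
    proof -
      have "w \<bullet> (s' - s - H z (- \<beta> *\<^sub>R s)) \<le> norm w * norm (s' - s - H z (- \<beta> *\<^sub>R s))"
        by (rule norm_cauchy_schwarz)
      also have "\<dots> \<le> L / \<sigma> * (L * (4 * L * R z))"
      proof (rule mult_mono)
        show "norm w \<le> L / \<sigma>" unfolding w_def by (rule wstar_bound)
        have "norm (s' - s - H z (- \<beta> *\<^sub>R s)) \<le> L * (norm v)\<^sup>2"
          using grad_y_taylor[of z v] by (simp add: s'_def s_def z'_def H_def v_def)
        also have "\<dots> \<le> L * (4 * L * R z)" using v2 L_pos by (intro mult_left_mono) auto
        finally show "norm (s' - s - H z (- \<beta> *\<^sub>R s)) \<le> L * (4 * L * R z)" .
      qed (use L_pos sigma in auto)
      finally show ?thesis by (simp add: inner_diff_right H_symmetric)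
    qed
    have 3: "(wstar z' - w) \<bullet> s' \<le> Lw * (4 * L * R z)"
    proof -
      have "(wstar z' - w) \<bullet> s' \<le> norm (wstar z' - w) * norm s'" by (rule norm_cauchy_schwarz)
      also have "\<dots> \<le> (Lw * norm v) * norm s'"
        using wstar_lipschitz[of z' z] by (intro mult_right_mono) (auto simp: w_def z'_def)
      also have "\<dots> = Lw * (norm v * norm s')" by simp
      also have "\<dots> \<le> Lw * (4 * L * R z)"
      proof (rule mult_left_mono[OF _ Lw_nonneg])
        have "2 * (norm v * norm s') \<le> (norm v)\<^sup>2 + (norm s')\<^sup>2"
          using sum_squares_bound[of "norm v" "norm s'"] by simp
        then show "norm v * norm s' \<le> 4 * L * R z" using v2 s'2 by linarith
      qed
      finally show ?thesis .
    qed
    have 4: "(snd (F z) + H z w) \<bullet> (- \<beta> *\<^sub>R s) \<le> 32 * L\<^sup>2 / \<mu> * R z"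
    proof -
      have k: "\<bar>(snd (F z) + H z w) \<bullet> s\<bar> \<le> 32 * L\<^sup>2 / \<mu> * R z"
        using kernel_part_of_grad_y[of x y "snd (F z) + H z w"] wstar_solves[of z] wstar_residual_bound[of z]
        by (simp add: z_def s_def w_def)
      have "(snd (F z) + H z w) \<bullet> (- \<beta> *\<^sub>R s) \<le> \<beta> * \<bar>(snd (F z) + H z w) \<bullet> s\<bar>"
        using \<beta> by (simp add: abs_if mult_le_0_iff zero_le_mult_iff)
      also have "\<dots> \<le> 1 * \<bar>(snd (F z) + H z w) \<bullet> s\<bar>" using \<beta> by (intro mult_right_mono) auto
      finally show ?thesis using k by simp
    qed
    have "\<Phi> z' - \<Phi> z = (f z' - f z) + w \<bullet> (s' - s) + (wstar z' - w) \<bullet> s'"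
      by (simp add: \<Phi>_def s_def s'_def w_def inner_diff_left inner_diff_right)
    also have "\<dots> \<le> (snd (F z) + H z w) \<bullet> (- \<beta> *\<^sub>R s) + L * (4 * L * R z) + L / \<sigma> * (L * (4 * L * R z)) + Lw * (4 * L * R z)"
      using 1 2 3 unfolding inner_add_left by linarith
    also have "\<dots> \<le> 32 * L\<^sup>2 / \<mu> * R z + L * (4 * L * R z) + L / \<sigma> * (L * (4 * L * R z)) + Lw * (4 * L * R z)"
      using 4 by simp
    also have "\<dots> = C * R z" by (simp add: C_def algebra_simps power2_eq_square)
    finally show ?thesis by (simp add: z' z_def \<beta>_def s_def)
  qed
  then show ?thesis using C by blast
qed

text \<open>
The term \<open>R (x', y)\<close> on the right comes from Young's inequality for the change of \<open>w*\<close> times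
\<open>grad_y g\<close> at the new point.
\<close>
lemma \<Phi>_change_x:
  "\<exists>C\<ge>0. \<forall>x x' y. \<Phi> (x', y) - \<Phi> (x, y)
      \<le> hypergrad (x, y) \<bullet> (x' - x) + C * (norm (x' - x))\<^sup>2 + R (x', y)"
proof -
  define C where "C = L + L / \<sigma> * L + L * Lw\<^sup>2"
  have C: "0 \<le> C" using L_pos sigma by (simp add: C_def)
  have "\<Phi> (x', y) - \<Phi> (x, y) \<le> hypergrad (x, y) \<bullet> (x' - x) + C * (norm (x' - x))\<^sup>2 + R (x', y)" for x x' y
  proof -
    define u where "u = x' - x"
    define z where "z = (x, y)"
    define v :: "'a \<times> 'b" where "v = (u, 0)"
    define z' where "z' = z + v"
    define s where "s = snd (G z)"
    define s' where "s' = snd (G z')"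
    define w where "w = wstar z"
    have z': "z' = (x', y)" by (simp add: z'_def z_def v_def u_def)
    have nv: "norm v = norm u" by (simp add: v_def norm_Pair)
    have 1: "f z' - f z \<le> fst (F z) \<bullet> u + L * (norm u)\<^sup>2"
      using f_taylor[of z v] by (simp add: z'_def v_def inner_prod_def norm_Pair)
    have 2: "w \<bullet> (s' - s) \<le> J z w \<bullet> u + L / \<sigma> * (L * (norm u)\<^sup>2)"
    proof -
      have "w \<bullet> (s' - s - snd (D z v)) \<le> norm w * norm (s' - s - snd (D z v))"
        by (rule norm_cauchy_schwarz)
      also have "\<dots> \<le> L / \<sigma> * (L * (norm u)\<^sup>2)"
        using grad_y_taylor[of z v] wstar_bound[of z] L_pos sigma
        by (intro mult_mono) (auto simp: s'_def s_def z'_def nv w_def)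
      finally show ?thesis by (simp add: inner_diff_right J_transpose v_def)
    qed
    have 3: "(wstar z' - w) \<bullet> s' \<le> L * Lw\<^sup>2 * (norm u)\<^sup>2 + R z'"
    proof -
      have "(wstar z' - w) \<bullet> s' \<le> norm (wstar z' - w) * norm s'" by (rule norm_cauchy_schwarz)
      also have "\<dots> \<le> (Lw * norm u) * norm s'"
        using wstar_lipschitz[of z' z] by (intro mult_right_mono) (auto simp: w_def z'_def nv)
      also have "\<dots> \<le> L * (Lw * norm u)\<^sup>2 + (norm s')\<^sup>2 / (4 * L)"
      proof -
        have "0 \<le> (2 * L * (Lw * norm u) - norm s')\<^sup>2" by simp
        then have "4 * L * ((Lw * norm u) * norm s') \<le> 4 * L * (L * (Lw * norm u)\<^sup>2) + (norm s')\<^sup>2"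
          by (simp add: power2_eq_square algebra_simps)
        then show ?thesis using L_pos by (simp add: field_simps)
      qed
      also have "(norm s')\<^sup>2 / (4 * L) \<le> R z'"
        using grad_y_sq_le[of z'] L_pos by (simp add: s'_def field_simps)
      finally show ?thesis by (simp add: power_mult_distrib mult_ac)
    qed
    have "\<Phi> z' - \<Phi> z = (f z' - f z) + w \<bullet> (s' - s) + (wstar z' - w) \<bullet> s'"
      by (simp add: \<Phi>_def s_def s'_def w_def inner_diff_left inner_diff_right)
    also have "\<dots> \<le> hypergrad z \<bullet> u + C * (norm u)\<^sup>2 + R z'"
      using 1 2 3 by (simp add: hypergrad_def C_def w_def inner_add_left algebra_simps)
    finally show ?thesis by (simp add: z' z_def u_def)
  qed
  then show ?thesis using C by blast
qed

text \<open>
The weight \<open>c\<close> is fixed first, so large that the contraction of \<open>R\<close> outweighs the multiples of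
\<open>R\<close> in the changes of \<open>\<Phi>\<close>; the price is a multiple of \<open>\<alpha>\<^sup>2 |d|\<^sup>2\<close>, which a small \<open>\<alpha>\<close> makes
negligible against the descent \<open>\<alpha> |d|\<^sup>2\<close>.
\<close>
lemma lyapunov_decrease:
  "\<exists>\<alpha>>0. \<exists>c\<ge>2. \<forall>x y d. let y' = y - (1 / (2 * L)) *\<^sub>R snd (G (x, y)); x' = x - \<alpha> *\<^sub>R d in
     \<Phi> (x', y') + c * R (x', y') + \<alpha> / 4 * (norm d)\<^sup>2 + R (x, y)
       \<le> \<Phi> (x, y) + c * R (x, y) + \<alpha> / 2 * (norm (d - hypergrad (x, y')))\<^sup>2"
proof -
  obtain C1 where C1: "0 \<le> C1"
    "\<And>x y. \<Phi> (x, y - (1 / (2 * L)) *\<^sub>R snd (G (x, y))) - \<Phi> (x, y) \<le> C1 * R (x, y)"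
    using \<Phi>_change_y by blast
  obtain C2 where C2: "0 \<le> C2" "\<And>x x' y. \<Phi> (x', y) - \<Phi> (x, y)
      \<le> hypergrad (x, y) \<bullet> (x' - x) + C2 * (norm (x' - x))\<^sup>2 + R (x', y)"
    using \<Phi>_change_x by blast
  define \<theta> where "\<theta> = \<mu> / (4 * L)"
  have \<theta>: "0 < \<theta>" "\<theta> \<le> 1" using mu L_ge_1 by (auto simp: \<theta>_def)
  obtain C3 where C3: "0 \<le> C3" "\<And>x x' y. R (x', y - (1 / (2 * L)) *\<^sub>R snd (G (x, y)))
      \<le> (1 - \<theta>) * R (x, y) + C3 * (norm (x' - x))\<^sup>2"
    using R_change_x unfolding \<theta>_def by blast
  \<comment> \<open>\<open>c \<theta> = C1 + 2\<close> covers \<open>C1 R\<close> from the \<open>y\<close>-step, \<open>R\<close> from the \<open>x\<close>-step and the claimed decrease by \<open>R\<close>\<close>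
  define c where "c = (C1 + 2) / \<theta>"
  have "2 * \<theta> \<le> C1 + 2" using C1 \<theta> by simp
  then have c: "2 \<le> c" using \<theta> by (simp add: c_def field_simps)
  define B where "B = C2 + C3 + c * C3"
  have B: "0 \<le> B" using C2 C3 c by (simp add: B_def)
  define \<alpha> where "\<alpha> = 1 / (4 * (B + 1))"
  have \<alpha>: "0 < \<alpha>" "B * \<alpha> \<le> 1 / 4" using B by (auto simp: \<alpha>_def field_simps)
  have "\<Phi> (x', y') + c * R (x', y') + \<alpha> / 4 * (norm d)\<^sup>2 + R (x, y)
       \<le> \<Phi> (x, y) + c * R (x, y) + \<alpha> / 2 * (norm (d - hypergrad (x, y')))\<^sup>2"
    if y': "y' = y - (1 / (2 * L)) *\<^sub>R snd (G (x, y))" and x': "x' = x - \<alpha> *\<^sub>R d" for x y d x' y'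
  proof -
    define q where "q = hypergrad (x, y')"
    define n where "n = (norm d)\<^sup>2"
    define e where "e = (norm (d - q))\<^sup>2"
    have xx: "(norm (x' - x))\<^sup>2 = \<alpha>\<^sup>2 * n" by (simp add: x' n_def power_mult_distrib)
    have 1: "\<Phi> (x, y') - \<Phi> (x, y) \<le> C1 * R (x, y)" unfolding y' by (rule C1)
    have 2: "\<Phi> (x', y') - \<Phi> (x, y') \<le> q \<bullet> (x' - x) + C2 * (\<alpha>\<^sup>2 * n) + R (x', y')"
      using C2(2)[of x' y' x] by (simp add: q_def xx)
    have 3: "R (x', y') \<le> (1 - \<theta>) * R (x, y) + C3 * (\<alpha>\<^sup>2 * n)"
      using C3(2)[of x' y x] by (simp add: y' xx)
    have 4: "q \<bullet> (x' - x) \<le> - (\<alpha> / 2) * n + \<alpha> / 2 * e"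
    proof -
      have "q \<bullet> (x' - x) = - \<alpha> * (q \<bullet> d)" by (simp add: x')
      moreover have "e = (norm q)\<^sup>2 - 2 * (q \<bullet> d) + n"
        by (simp add: e_def n_def power2_norm_eq_inner inner_diff_left inner_diff_right inner_commute)
      then have "\<alpha> / 2 * (n - e) \<le> \<alpha> / 2 * (2 * (q \<bullet> d))" using \<alpha> by (intro mult_left_mono) auto
      ultimately show ?thesis by (simp add: algebra_simps)
    qed
    have "(1 + c) * R (x', y') \<le> (1 + c) * ((1 - \<theta>) * R (x, y) + C3 * (\<alpha>\<^sup>2 * n))"
      using 3 c by (intro mult_left_mono) auto
    also have "\<dots> = (1 + c) * R (x, y) - (\<theta> + (C1 + 2)) * R (x, y) + (C3 + c * C3) * (\<alpha>\<^sup>2 * n)"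
    proof -
      have "c * \<theta> = C1 + 2" using \<theta> by (simp add: c_def)
      then have "C1 + 2 = c * \<theta>" by simp
      then show ?thesis by (simp only:) (simp add: algebra_simps)
    qed
    finally have 5: "(1 + c) * R (x', y') \<le> (1 + c) * R (x, y) - (\<theta> + (C1 + 2)) * R (x, y) + (C3 + c * C3) * (\<alpha>\<^sup>2 * n)" .
    have 6: "0 \<le> \<theta> * R (x, y)" using \<theta> R_nonneg by simp
    have "B * (\<alpha>\<^sup>2 * n) = (B * \<alpha>) * (\<alpha> * n)" by (simp add: power2_eq_square)
    also have "\<dots> \<le> 1 / 4 * (\<alpha> * n)" using \<alpha> by (intro mult_right_mono) (auto simp: n_def)
    finally have 7: "B * (\<alpha>\<^sup>2 * n) \<le> \<alpha> / 4 * n" by simp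
    have 8: "B * (\<alpha>\<^sup>2 * n) = C2 * (\<alpha>\<^sup>2 * n) + (C3 + c * C3) * (\<alpha>\<^sup>2 * n)"
      by (simp add: B_def algebra_simps)
    have "\<Phi> (x', y') + c * R (x', y') + \<alpha> / 4 * n + R (x, y) \<le> \<Phi> (x, y) + c * R (x, y) + \<alpha> / 2 * e"
      using 1 2 4 5 6 7 unfolding 8 by (simp add: algebra_simps)
    then show ?thesis by (simp add: n_def e_def q_def)
  qed
  then show ?thesis using \<alpha>(1) c unfolding Let_def by blast
qed

text \<open>
At a nearby lower-level solution \<open>f\<close> is at least \<open>fs\<close>, and \<open>f\<close> and \<open>w* \<bullet> grad_y g\<close> lose at most
\<open>O(sqrt R)\<close> against it, which \<open>c R\<close> absorbs up to a constant.
\<close>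
lemma lyapunov_lower_bound:
  assumes c: "2 \<le> c"
  shows "fs - (8 * L\<^sup>2 / \<mu> + L ^ 3 / \<sigma>\<^sup>2) \<le> \<Phi> z + c * R z"
proof -
  obtain x y where z: "z = (x, y)" by (cases z)
  obtain yb where yb: "g (x, yb) = gs x" and eb: "(norm (y - yb))\<^sup>2 \<le> 32 / \<mu> * R (x, y)"
    by (rule error_bound)
  define b where "b = norm (y - yb)"
  define s where "s = norm (snd (G z))"
  have "f (x, yb) - f (x, y) \<le> L * b" using f_lip_y[of x yb y] by (simp add: b_def norm_minus_commute)
  then have 1: "fs - L * b \<le> f z" using f_lower[OF yb] z by simp
  have 2: "L * b \<le> R z + 8 * L\<^sup>2 / \<mu>"
  proof -
    have "0 \<le> (\<mu> / 16 * b - L)\<^sup>2" by simp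
    then have "\<mu> / 8 * (L * b) \<le> (\<mu> / 16)\<^sup>2 * b\<^sup>2 + L\<^sup>2"
      by (simp add: power2_eq_square algebra_simps)
    also have "(\<mu> / 16)\<^sup>2 * b\<^sup>2 \<le> (\<mu> / 16)\<^sup>2 * (32 / \<mu> * R z)"
      using eb by (intro mult_left_mono) (auto simp: b_def z)
    also have "\<dots> = \<mu> / 8 * R z" using mu by (simp add: power2_eq_square)
    finally show ?thesis using mu by (simp add: field_simps)
  qed
  have 3: "- (wstar z \<bullet> snd (G z)) \<le> R z + L ^ 3 / \<sigma>\<^sup>2"
  proof -
    have "- (wstar z \<bullet> snd (G z)) \<le> norm (wstar z) * s"
      using Cauchy_Schwarz_ineq2[of "wstar z" "snd (G z)"] by (simp add: s_def)
    also have "\<dots> \<le> (L / \<sigma>) * s" by (intro mult_right_mono wstar_bound) (simp add: s_def)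
    also have "\<dots> \<le> s\<^sup>2 / (4 * L) + L * (L / \<sigma>)\<^sup>2"
    proof -
      have "0 \<le> (s - 2 * L * (L / \<sigma>))\<^sup>2" by simp
      then have "4 * L * ((L / \<sigma>) * s) \<le> s\<^sup>2 + 4 * L * (L * (L / \<sigma>)\<^sup>2)"
        unfolding power2_diff by (simp add: power2_eq_square mult_ac)
      then have "4 * L * ((L / \<sigma>) * s) \<le> 4 * L * (s\<^sup>2 / (4 * L) + L * (L / \<sigma>)\<^sup>2)"
        using L_pos by (simp add: distrib_left)
      then show ?thesis by (rule mult_left_le_imp_le) (use L_pos in simp)
    qed
    also have "s\<^sup>2 / (4 * L) \<le> R z" using grad_y_sq_le[of z] L_pos by (simp add: s_def field_simps)
    finally show ?thesis by (simp add: power_divide power2_eq_square power3_eq_cube)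
  qed
  have "2 * R z \<le> c * R z" using c R_nonneg by (intro mult_right_mono) auto
  with 1 2 3 show ?thesis by (simp add: \<Phi>_def)
qed

section \<open>Summing the residuals\<close>

definition inner_w :: "nat \<Rightarrow> 'a \<times> 'b \<Rightarrow> 'b" where
  "inner_w T z = ((\<lambda>v. v - (1 / L\<^sup>2) *\<^sub>R H z (snd (F z) + H z v)) ^^ T) 0"

lemma contraction_factor: "0 \<le> 1 - \<sigma>\<^sup>2 / L\<^sup>2" "1 - \<sigma>\<^sup>2 / L\<^sup>2 \<le> 1"
proof -
  have "\<sigma>\<^sup>2 \<le> L\<^sup>2" using sigma L_ge_1 by (intro power_mono) auto
  then show "0 \<le> 1 - \<sigma>\<^sup>2 / L\<^sup>2" "1 - \<sigma>\<^sup>2 / L\<^sup>2 \<le> 1" using L_pos by auto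
qed

lemma inner_w_error: "(norm (inner_w T z - wstar z))\<^sup>2 \<le> (1 - \<sigma>\<^sup>2 / L\<^sup>2) ^ T * (L / \<sigma>)\<^sup>2"
proof -
  have "(norm (inner_w T z - wstar z))\<^sup>2 \<le> (1 - \<sigma>\<^sup>2 / L\<^sup>2) ^ T * (norm (wstar z))\<^sup>2"
    unfolding inner_w_def using sigma L_ge_1
    by (intro H.gradient_iteration_converges H_bound wstar_range wstar_solves) auto
  also have "\<dots> \<le> (1 - \<sigma>\<^sup>2 / L\<^sup>2) ^ T * (L / \<sigma>)\<^sup>2"
    using contraction_factor by (intro mult_left_mono power_mono wstar_bound zero_le_power) auto
  finally show ?thesis .
qed

lemma inner_w_bound: "norm (inner_w T z) \<le> 2 * L / \<sigma>"
proof -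
  have "(norm (inner_w T z - wstar z))\<^sup>2 \<le> 1 * (L / \<sigma>)\<^sup>2"
    using contraction_factor
    by (intro order_trans[OF inner_w_error] mult_right_mono power_le_one) auto
  then have "norm (inner_w T z - wstar z) \<le> L / \<sigma>"
    using L_pos sigma by (simp add: power2_le_iff_abs_le)
  then show ?thesis
    using norm_triangle_ineq[of "inner_w T z - wstar z" "wstar z"] wstar_bound[of z] by simp
qed

text \<open>
The vector \<open>w\<close> is bounded, so the direction is Lipschitz in \<open>x\<close> at fixed \<open>w\<close>.
\<close>
lemma residual_x_transfer:
  "\<exists>C\<ge>0. \<forall>x x' y w. norm w \<le> 2 * L / \<sigma> \<longrightarrow> (norm (fst (F (x', y)) + J (x', y) w))\<^sup>2
      \<le> 2 * (norm (fst (F (x, y)) + J (x, y) w))\<^sup>2 + C * (norm (x' - x))\<^sup>2"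
proof -
  define M where "M = L + L * (2 * L / \<sigma>)"
  have "(norm (fst (F (x', y)) + J (x', y) w))\<^sup>2
      \<le> 2 * (norm (fst (F (x, y)) + J (x, y) w))\<^sup>2 + 2 * M\<^sup>2 * (norm (x' - x))\<^sup>2"
    if w: "norm w \<le> 2 * L / \<sigma>" for x x' y w
  proof -
    let ?a = "fst (F (x, y)) + J (x, y) w" and ?b = "fst (F (x', y)) + J (x', y) w"
    have "norm (fst (F (x', y)) - fst (F (x, y))) \<le> L * norm (x' - x)"
      using order_trans[OF norm_fst F_lip[of "(x', y)" "(x, y)"]] by (simp add: norm_Pair)
    moreover have "norm (J (x', y) w - J (x, y) w) \<le> L * norm (x' - x) * (2 * L / \<sigma>)"
      using order_trans[OF J_diff[of "(x', y)" w "(x, y)"] mult_left_mono[OF w]] L_pos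
      by (simp add: norm_Pair)
    ultimately have "norm (?b - ?a) \<le> M * norm (x' - x)"
      using norm_triangle_ineq[of "fst (F (x', y)) - fst (F (x, y))" "J (x', y) w - J (x, y) w"]
      by (simp add: M_def algebra_simps)
    then have d: "(norm (?b - ?a))\<^sup>2 \<le> (M * norm (x' - x))\<^sup>2" by (intro power_mono) auto
    have "(norm ?b)\<^sup>2 \<le> (norm ?a + norm (?b - ?a))\<^sup>2"
      using norm_triangle_ineq[of ?a "?b - ?a"] by (intro power_mono) auto
    also have "\<dots> \<le> 2 * (norm ?a)\<^sup>2 + 2 * (norm (?b - ?a))\<^sup>2"
      using sum_squares_bound[of "norm ?a" "norm (?b - ?a)"] by (simp add: power2_sum)
    finally show ?thesis using d by (simp add: power_mult_distrib)
  qed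
  then show ?thesis by (intro exI[of _ "2 * M\<^sup>2"]) auto
qed

text \<open>
At \<open>(x, y)\<close> itself the residual vector is \<open>H (H (w - wstar))\<close>, by the equation for \<open>wstar\<close>;
moving to \<open>x'\<close> changes it by \<open>O(|x' - x|)\<close>, as all vectors involved are bounded.
\<close>
lemma residual_w_transfer:
  "\<exists>C\<ge>0. \<forall>x x' y w. norm w \<le> 2 * L / \<sigma> \<longrightarrow>
     (norm (H (x', y) (snd (F (x', y)) + H (x', y) w)))\<^sup>2
      \<le> C * (norm (w - wstar (x, y)))\<^sup>2 + C * (norm (x' - x))\<^sup>2"
proof -
  define m where "m = L + L * (2 * L / \<sigma>)"
  define M where "M = 2 * L * m"
  have "(norm (H (x', y) (snd (F (x', y)) + H (x', y) w)))\<^sup>2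
      \<le> (2 * M\<^sup>2 + 2 * L ^ 4) * (norm (w - wstar (x, y)))\<^sup>2 + (2 * M\<^sup>2 + 2 * L ^ 4) * (norm (x' - x))\<^sup>2"
    if w: "norm w \<le> 2 * L / \<sigma>" for x x' y w
  proof -
    define z where "z = (x, y)"
    define z' where "z' = (x', y)"
    have zz: "norm (z' - z) = norm (x' - x)" by (simp add: z_def z'_def norm_Pair)
    define r where "r = snd (F z) + H z w"
    define r' where "r' = snd (F z') + H z' w"
    have r: "norm r \<le> m"
    proof -
      have "norm (H z w) \<le> L * (2 * L / \<sigma>)"
        using order_trans[OF H_bound mult_left_mono[OF w]] L_pos by simp
      then show ?thesis unfolding r_def m_def
        using norm_triangle_ineq[of "snd (F z)" "H z w"] grad_y_f_bound[of z] by linarith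
    qed
    have "norm (snd (F z') - snd (F z)) \<le> L * norm (x' - x)"
      using order_trans[OF norm_snd F_lip[of z' z]] by (simp add: zz)
    moreover have "norm (H z' w - H z w) \<le> L * norm (x' - x) * (2 * L / \<sigma>)"
      using order_trans[OF H_diff[of z' w z] mult_left_mono[OF w]] L_pos
      by (simp add: zz)
    ultimately have rr: "norm (r' - r) \<le> m * norm (x' - x)"
      using norm_triangle_ineq[of "snd (F z') - snd (F z)" "H z' w - H z w"]
      by (simp add: m_def r_def r'_def algebra_simps)
    have "H z' r' - H z r = H z' (r' - r) + (H z' r - H z r)"
      by (simp add: linear_diff[OF H_linear])
    moreover have "norm (H z' (r' - r)) \<le> L * (m * norm (x' - x))"
      using order_trans[OF H_bound mult_left_mono[OF rr]] L_pos by simp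
    moreover have "norm (H z' r - H z r) \<le> L * norm (x' - x) * m"
      using order_trans[OF H_diff[of z' r z] mult_left_mono[OF r]] L_pos by (simp add: zz)
    ultimately have d: "norm (H z' r' - H z r) \<le> M * norm (x' - x)"
      using norm_triangle_ineq[of "H z' (r' - r)" "H z' r - H z r"] by (simp add: M_def algebra_simps)
    have "H z r = H z (H z (w - wstar z))"
    proof -
      have "r = (snd (F z) + H z (wstar z)) + H z (w - wstar z)"
        by (simp add: r_def linear_diff[OF H_linear])
      then show ?thesis using wstar_solves[of z] by (simp only: linear_add[OF H_linear]) simp
    qed
    then have e: "norm (H z r) \<le> L\<^sup>2 * norm (w - wstar z)"
      using order_trans[OF H_bound[of z "H z (w - wstar z)"] mult_left_mono[OF H_bound[of z "w - wstar z"]]] L_pos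
      by (simp add: power2_eq_square mult.assoc)
    have "(norm (H z' r'))\<^sup>2 \<le> (norm (H z r) + norm (H z' r' - H z r))\<^sup>2"
      using norm_triangle_ineq[of "H z r" "H z' r' - H z r"] by (intro power_mono) auto
    also have "\<dots> \<le> 2 * (norm (H z r))\<^sup>2 + 2 * (norm (H z' r' - H z r))\<^sup>2"
      using sum_squares_bound[of "norm (H z r)" "norm (H z' r' - H z r)"] by (simp add: power2_sum)
    also have "\<dots> \<le> 2 * (L\<^sup>2 * norm (w - wstar z))\<^sup>2 + 2 * (M * norm (x' - x))\<^sup>2"
      using d e by (intro add_mono mult_left_mono power_mono) auto
    also have "\<dots> = 2 * L ^ 4 * (norm (w - wstar z))\<^sup>2 + 2 * M\<^sup>2 * (norm (x' - x))\<^sup>2"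
      by (simp add: power_mult_distrib)
    also have "\<dots> \<le> (2 * M\<^sup>2 + 2 * L ^ 4) * (norm (w - wstar z))\<^sup>2 + (2 * M\<^sup>2 + 2 * L ^ 4) * (norm (x' - x))\<^sup>2"
      by (intro add_mono mult_right_mono) auto
    finally show ?thesis by (simp add: z_def z'_def r'_def)
  qed
  then show ?thesis by (intro exI[of _ "2 * M\<^sup>2 + 2 * L ^ 4"]) auto
qed

text \<open>
Telescoping the Lyapunov function bounds the sums of \<open>|d|\<^sup>2\<close> and \<open>R\<close>: the condition on \<open>K\<close> and
\<open>T\<close> says that the accumulated error of the \<open>w\<close>-iteration is bounded. The other two residuals
are transferred from the previous round, so that the initial residual enters separately.
\<close>
lemma residual_sums_bounded:
  "\<exists>\<alpha>>0. \<exists>C. \<forall>T K x y w.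
     x 0 = x0 \<longrightarrow> y 0 = y0 \<longrightarrow> w 0 = 0 \<longrightarrow>
     (\<forall>k. y (Suc k) = y k - (1 / (2 * L)) *\<^sub>R snd (G (x k, y k))) \<longrightarrow>
     (\<forall>k. w (Suc k) = inner_w T (x k, y (Suc k))) \<longrightarrow>
     (\<forall>k. x (Suc k) = x k - \<alpha> *\<^sub>R (fst (F (x k, y (Suc k))) + J (x k, y (Suc k)) (w (Suc k)))) \<longrightarrow>
     real K * (1 - \<sigma>\<^sup>2 / L\<^sup>2) ^ T \<le> 1 \<longrightarrow>
     (\<Sum>k<K. (norm (fst (F (x k, y k)) + J (x k, y k) (w k)))\<^sup>2) \<le> C \<and>
     (\<Sum>k<K. (norm (H (x k, y k) (snd (F (x k, y k)) + H (x k, y k) (w k))))\<^sup>2) \<le> C \<and>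
     (\<Sum>k<K. R (x k, y k)) \<le> C"
proof -
  obtain \<alpha> c where \<alpha>: "0 < \<alpha>" and c: "2 \<le> c" and
    dec: "\<And>x y d x' y'. y' = y - (1 / (2 * L)) *\<^sub>R snd (G (x, y)) \<Longrightarrow> x' = x - \<alpha> *\<^sub>R d \<Longrightarrow>
     \<Phi> (x', y') + c * R (x', y') + \<alpha> / 4 * (norm d)\<^sup>2 + R (x, y)
       \<le> \<Phi> (x, y) + c * R (x, y) + \<alpha> / 2 * (norm (d - hypergrad (x, y')))\<^sup>2"
    using lyapunov_decrease unfolding Let_def by blast
  obtain C1 where C1: "0 \<le> C1" "\<And>x x' y w. norm w \<le> 2 * L / \<sigma> \<Longrightarrow>
      (norm (fst (F (x', y)) + J (x', y) w))\<^sup>2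
      \<le> 2 * (norm (fst (F (x, y)) + J (x, y) w))\<^sup>2 + C1 * (norm (x' - x))\<^sup>2"
    using residual_x_transfer by blast
  obtain C2 where C2: "0 \<le> C2" "\<And>x x' y w. norm w \<le> 2 * L / \<sigma> \<Longrightarrow>
     (norm (H (x', y) (snd (F (x', y)) + H (x', y) w)))\<^sup>2
      \<le> C2 * (norm (w - wstar (x, y)))\<^sup>2 + C2 * (norm (x' - x))\<^sup>2"
    using residual_w_transfer by blast
  define V where "V z = \<Phi> z + c * R z" for z
  define Vlow where "Vlow = fs - (8 * L\<^sup>2 / \<mu> + L ^ 3 / \<sigma>\<^sup>2)"
  \<comment> \<open>the last summand bounds the error of all \<open>w\<close>-iterations together\<close>
  define A where "A = V (x0, y0) - Vlow + \<alpha> / 2 * (L\<^sup>2 * (L / \<sigma>)\<^sup>2)"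
  define rx0 where "rx0 = (norm (fst (F (x0, y0)) + J (x0, y0) 0))\<^sup>2"
  define rw0 where "rw0 = (norm (H (x0, y0) (snd (F (x0, y0)) + H (x0, y0) 0)))\<^sup>2"
  define Cx where "Cx = rx0 + (2 + C1 * \<alpha>\<^sup>2) * (4 / \<alpha> * A)"
  define Cw where "Cw = rw0 + (C2 * (L / \<sigma>)\<^sup>2 + C2 * \<alpha>\<^sup>2 * (4 / \<alpha> * A))"
  have main: "(\<Sum>k<K. (norm (fst (F (x k, y k)) + J (x k, y k) (w k)))\<^sup>2) \<le> Cx \<and>
     (\<Sum>k<K. (norm (H (x k, y k) (snd (F (x k, y k)) + H (x k, y k) (w k))))\<^sup>2) \<le> Cw \<and>
     (\<Sum>k<K. R (x k, y k)) \<le> A"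
    if x0: "x 0 = x0" and y0: "y 0 = y0" and w0: "w 0 = 0"
      and y: "\<And>k. y (Suc k) = y k - (1 / (2 * L)) *\<^sub>R snd (G (x k, y k))"
      and w: "\<And>k. w (Suc k) = inner_w T (x k, y (Suc k))"
      and x: "\<And>k. x (Suc k) = x k - \<alpha> *\<^sub>R (fst (F (x k, y (Suc k))) + J (x k, y (Suc k)) (w (Suc k)))"
      and KT: "real K * (1 - \<sigma>\<^sup>2 / L\<^sup>2) ^ T \<le> 1"
    for T K x y w
  proof -
    define q where "q = (1 - \<sigma>\<^sup>2 / L\<^sup>2) ^ T"
    define d where "d k = fst (F (x k, y (Suc k))) + J (x k, y (Suc k)) (w (Suc k))" for k
    have xd: "x (Suc k) = x k - \<alpha> *\<^sub>R d k" for k using x by (simp add: d_def)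
    have xx: "(norm (x (Suc k) - x k))\<^sup>2 = \<alpha>\<^sup>2 * (norm (d k))\<^sup>2" for k
      by (simp add: xd power_mult_distrib)
    have werr: "(norm (w (Suc k) - wstar (x k, y (Suc k))))\<^sup>2 \<le> q * (L / \<sigma>)\<^sup>2" for k
      unfolding w q_def by (rule inner_w_error)
    have derr: "(norm (d k - hypergrad (x k, y (Suc k))))\<^sup>2 \<le> L\<^sup>2 * (q * (L / \<sigma>)\<^sup>2)" for k
    proof -
      have "d k - hypergrad (x k, y (Suc k)) = J (x k, y (Suc k)) (w (Suc k) - wstar (x k, y (Suc k)))"
        by (simp add: d_def hypergrad_def linear_diff[OF J_linear])
      then have "(norm (d k - hypergrad (x k, y (Suc k))))\<^sup>2 \<le> (L * norm (w (Suc k) - wstar (x k, y (Suc k))))\<^sup>2"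
        by (simp add: J_bound power_mono)
      also have "\<dots> \<le> L\<^sup>2 * (q * (L / \<sigma>)\<^sup>2)"
        unfolding power_mult_distrib by (intro mult_left_mono werr) auto
      finally show ?thesis .
    qed
    have Kq: "real K * q \<le> 1" using KT by (simp add: q_def)
    have step: "\<alpha> / 4 * (norm (d k))\<^sup>2 + R (x k, y k)
        \<le> V (x k, y k) - V (x (Suc k), y (Suc k)) + \<alpha> / 2 * (L\<^sup>2 * (q * (L / \<sigma>)\<^sup>2))" for k
    proof -
      have "\<alpha> / 2 * (norm (d k - hypergrad (x k, y (Suc k))))\<^sup>2 \<le> \<alpha> / 2 * (L\<^sup>2 * (q * (L / \<sigma>)\<^sup>2))"
        using \<alpha> by (intro mult_left_mono derr) auto
      with dec[OF y xd, of k] show ?thesis by (simp add: V_def)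
    qed
    have "(\<Sum>k<K. \<alpha> / 4 * (norm (d k))\<^sup>2 + R (x k, y k))
        \<le> (\<Sum>k<K. V (x k, y k) - V (x (Suc k), y (Suc k)) + \<alpha> / 2 * (L\<^sup>2 * (q * (L / \<sigma>)\<^sup>2)))"
      by (intro sum_mono step)
    also have "\<dots> = V (x0, y0) - V (x K, y K) + (real K * q) * (\<alpha> / 2 * (L\<^sup>2 * (L / \<sigma>)\<^sup>2))"
      using sum_lessThan_telescope'[of "\<lambda>k. V (x k, y k)" K] by (simp add: sum.distrib x0 y0)
    also have "\<dots> \<le> V (x0, y0) - Vlow + 1 * (\<alpha> / 2 * (L\<^sup>2 * (L / \<sigma>)\<^sup>2))"
      using \<alpha> lyapunov_lower_bound[OF c] Kq
      by (intro add_mono diff_mono mult_right_mono) (auto simp: V_def Vlow_def)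
    finally have total: "\<alpha> / 4 * (\<Sum>k<K. (norm (d k))\<^sup>2) + (\<Sum>k<K. R (x k, y k)) \<le> A"
      by (simp add: sum.distrib sum_distrib_left A_def)
    have Rsum: "(\<Sum>k<K. R (x k, y k)) \<le> A"
      using total \<alpha> sum_nonneg[of "{..<K}" "\<lambda>k. (norm (d k))\<^sup>2"]
      by (smt (verit) divide_pos_pos mult_nonneg_nonneg zero_le_power2)
    have dsum: "(\<Sum>k<K. (norm (d k))\<^sup>2) \<le> 4 / \<alpha> * A"
    proof -
      have "0 \<le> (\<Sum>k<K. R (x k, y k))" by (intro sum_nonneg R_nonneg)
      then have "\<alpha> / 4 * (\<Sum>k<K. (norm (d k))\<^sup>2) \<le> A" using total by linarith
      then show ?thesis using \<alpha> by (simp add: field_simps)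
    qed
    have wb: "norm (w (Suc k)) \<le> 2 * L / \<sigma>" for k unfolding w by (rule inner_w_bound)
    have "(\<Sum>k<K. (norm (fst (F (x k, y k)) + J (x k, y k) (w k)))\<^sup>2)
        \<le> (norm (fst (F (x 0, y 0)) + J (x 0, y 0) (w 0)))\<^sup>2 + (\<Sum>k<K. (2 + C1 * \<alpha>\<^sup>2) * (norm (d k))\<^sup>2)"
    proof (rule sum_le_first_plus_shifted)
      show "(norm (fst (F (x (Suc k), y (Suc k))) + J (x (Suc k), y (Suc k)) (w (Suc k))))\<^sup>2
          \<le> (2 + C1 * \<alpha>\<^sup>2) * (norm (d k))\<^sup>2" for k
        using C1(2)[OF wb, of "x (Suc k)" "y (Suc k)" k "x k"] unfolding xx d_def
        by (simp add: algebra_simps)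
    qed simp
    also have "\<dots> = rx0 + (2 + C1 * \<alpha>\<^sup>2) * (\<Sum>k<K. (norm (d k))\<^sup>2)"
      by (simp add: x0 y0 w0 rx0_def sum_distrib_left)
    also have "\<dots> \<le> Cx" unfolding Cx_def using C1 by (intro add_left_mono mult_left_mono dsum) auto
    finally have Sx: "(\<Sum>k<K. (norm (fst (F (x k, y k)) + J (x k, y k) (w k)))\<^sup>2) \<le> Cx" .
    have "(\<Sum>k<K. (norm (H (x k, y k) (snd (F (x k, y k)) + H (x k, y k) (w k))))\<^sup>2)
        \<le> (norm (H (x 0, y 0) (snd (F (x 0, y 0)) + H (x 0, y 0) (w 0))))\<^sup>2
          + (\<Sum>k<K. C2 * (q * (L / \<sigma>)\<^sup>2) + C2 * \<alpha>\<^sup>2 * (norm (d k))\<^sup>2)"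
    proof (rule sum_le_first_plus_shifted)
      fix k
      have "C2 * (norm (w (Suc k) - wstar (x k, y (Suc k))))\<^sup>2 \<le> C2 * (q * (L / \<sigma>)\<^sup>2)"
        by (intro mult_left_mono werr C1 C2)
      with C2(2)[OF wb, of "x (Suc k)" "y (Suc k)" k "x k"]
      show "(norm (H (x (Suc k), y (Suc k)) (snd (F (x (Suc k), y (Suc k))) + H (x (Suc k), y (Suc k)) (w (Suc k)))))\<^sup>2
        \<le> C2 * (q * (L / \<sigma>)\<^sup>2) + C2 * \<alpha>\<^sup>2 * (norm (d k))\<^sup>2"
        unfolding xx by (simp add: mult.assoc)
    qed simp
    also have "\<dots> = rw0 + ((real K * q) * (C2 * (L / \<sigma>)\<^sup>2) + C2 * \<alpha>\<^sup>2 * (\<Sum>k<K. (norm (d k))\<^sup>2))"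
      by (simp add: x0 y0 w0 rw0_def sum_distrib_left sum.distrib)
    also have "\<dots> \<le> rw0 + (1 * (C2 * (L / \<sigma>)\<^sup>2) + C2 * \<alpha>\<^sup>2 * (4 / \<alpha> * A))"
      using C2 by (intro add_left_mono add_mono mult_right_mono mult_left_mono dsum Kq) auto
    also have "\<dots> = Cw" by (simp add: Cw_def)
    finally show ?thesis using Sx Rsum by blast
  qed
  show ?thesis
    using \<alpha> main by (intro exI[of _ \<alpha>] exI[of _ "max Cx (max Cw A)"] conjI allI impI)
      (auto simp: le_max_iff_disj)
qed

end

section \<open>Asymptotic orders\<close>

lemma bounded_sums_imp_mean_bigo:
  fixes S :: "nat \<Rightarrow> real"
  assumes "\<And>K. 0 \<le> S K" "\<And>K. S K \<le> C"
  shows "(\<lambda>K. 1 / real K * S K) \<in> O(\<lambda>K. 1 / real K)"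
proof (rule bigoI)
  show "\<forall>\<^sub>F K in sequentially. norm (1 / real K * S K) \<le> C * norm (1 / real K)"
    using assms by (intro always_eventually allI) (simp add: abs_mult divide_right_mono)
qed

text \<open>
Since \<open>1 - a \<le> exp (- a)\<close>, the factor \<open>1/K\<close> is reached after \<open>ln K / a\<close> steps.
\<close>
lemma logarithmic_iteration_count:
  fixes a :: real
  assumes a: "0 < a" "a \<le> 1"
  defines "T \<equiv> \<lambda>K. nat \<lceil>ln (real K) / a\<rceil> + 1"
  shows "real K * (1 - a) ^ T K \<le> 1" and "(\<lambda>K. real (T K)) \<in> O(\<lambda>K. ln (real K))"
proof -
  show "real K * (1 - a) ^ T K \<le> 1"
  proof (cases "K = 0")
    case False
    have "(1 - a) ^ T K \<le> exp (- a) ^ T K"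
      using a exp_ge_add_one_self[of "- a"] by (intro power_mono) auto
    also have "\<dots> = exp (- (a * real (T K)))" by (simp add: exp_of_nat_mult[symmetric] mult_ac)
    also have "\<dots> \<le> exp (- ln (real K))"
    proof -
      have "ln (real K) / a \<le> real (T K)" unfolding T_def by linarith
      then show ?thesis using a by (simp add: field_simps)
    qed
    also have "\<dots> = 1 / real K" using False by (simp add: exp_minus inverse_eq_divide)
    finally show ?thesis using False by (simp add: field_simps)
  qed simp
  show "(\<lambda>K. real (T K)) \<in> O(\<lambda>K. ln (real K))"
  proof (rule bigoI)
    \<comment> \<open>from \<open>K = 3\<close> on, \<open>ln K \<ge> 1\<close> also covers rounding up and the added step\<close>
    have "real (T K) \<le> (1 / a + 2) * norm (ln (real K))" if "3 \<le> K" for K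
    proof -
      have "exp (1 :: real) \<le> 3" by (rule exp_le)
      also have "\<dots> \<le> real K" using that by simp
      finally have 1: "1 \<le> ln (real K)" using that by (simp add: ln_ge_iff)
      then have "0 \<le> ln (real K) / a" using a by simp
      then have "real (T K) \<le> ln (real K) / a + 2" unfolding T_def by linarith
      also have "\<dots> \<le> (1 / a + 2) * norm (ln (real K))" using 1 by (simp add: algebra_simps)
      finally show ?thesis .
    qed
    then show "\<forall>\<^sub>F K in sequentially. norm (real (T K)) \<le> (1 / a + 2) * norm (ln (real K))"
      unfolding eventually_sequentially by (intro exI[of _ 3]) auto
  qed
qed

section \<open>Partial gradients and Hessian blocks in terms of the full derivatives\<close>

lemma grad_x_eq_fst:
  assumes "GDERIV h z :> E" shows "grad_x h z = fst E"
proof -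
  have "((\<lambda>x. (x, snd z)) has_derivative (\<lambda>h. (h, 0))) (at (fst z))"
    by (auto intro!: derivative_eq_intros)
  from has_derivative_compose[OF this, of h "\<lambda>v. v \<bullet> E"] assms
  have "GDERIV (\<lambda>x. h (x, snd z)) (fst z) :> fst E" by (simp add: gderiv_def inner_prod_def)
  then show ?thesis unfolding grad_x_def by (rule gradient_eqI)
qed

lemma grad_y_eq_snd:
  assumes "GDERIV h z :> E" shows "grad_y h z = snd E"
proof -
  have "((\<lambda>y. (fst z, y)) has_derivative (\<lambda>h. (0, h))) (at (snd z))"
    by (auto intro!: derivative_eq_intros)
  from has_derivative_compose[OF this, of h "\<lambda>v. v \<bullet> E"] assms
  have "GDERIV (\<lambda>y. h (fst z, y)) (snd z) :> snd E" by (simp add: gderiv_def inner_prod_def)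
  then show ?thesis unfolding grad_y_def by (rule gradient_eqI)
qed

lemma hess_yy_eq:
  fixes h :: "(real^'m) \<times> (real^'n) \<Rightarrow> real"
  assumes G: "\<And>z. GDERIV h z :> G z"
    and D: "(G has_derivative blinfun_apply (D z)) (at z)"
  shows "hess_yy h z *v v = snd (D z (0, v))"
proof -
  have "((\<lambda>y. (fst z, y)) has_derivative (\<lambda>h. (0, h))) (at (snd z))"
    by (auto intro!: derivative_eq_intros)
  from has_derivative_compose[OF this, of G "D z"] D
  have "((\<lambda>y. snd (G (fst z, y))) has_derivative (\<lambda>h. snd (D z (0, h)))) (at (snd z))"
    by (auto intro: has_derivative_snd)
  moreover have "(\<lambda>y. grad_y h (fst z, y)) = (\<lambda>y. snd (G (fst z, y)))"
    using grad_y_eq_snd[OF G] by simp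
  ultimately have der: "((\<lambda>y. grad_y h (fst z, y)) has_derivative (\<lambda>h. snd (D z (0, h)))) (at (snd z))"
    by simp
  then have "((\<lambda>y. grad_y h (fst z, y)) has_derivative (\<lambda>v. hess_yy h z *v v)) (at (snd z))"
    unfolding hess_yy_def jacobian_works[symmetric] by (rule differentiableI)
  from has_derivative_unique[OF this der] show ?thesis by (rule fun_cong)
qed

text \<open>
The \<open>xy\<close>-block is defined through gradients in \<open>x\<close>; the symmetry of the full second derivative
moves \<open>w\<close> to the \<open>y\<close>-slot.
\<close>
lemma hess_xy_eq:
  fixes h :: "(real^'m) \<times> (real^'n) \<Rightarrow> real"
  assumes G: "\<And>z. GDERIV h z :> G z"
    and D: "(G has_derivative blinfun_apply (D z)) (at z)"
    and sym: "\<And>u v. u \<bullet> D z v = D z u \<bullet> v"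
  shows "hess_xy h z *v w = fst (D z (0, w))"
proof -
  have "((\<lambda>x. (x, snd z)) has_derivative (\<lambda>h. (h, 0))) (at (fst z))"
    by (auto intro!: derivative_eq_intros)
  from has_derivative_compose[OF this, of G "D z"] D
  have "((\<lambda>x. snd (G (x, snd z))) has_derivative (\<lambda>h. snd (D z (h, 0)))) (at (fst z))"
    by (auto intro: has_derivative_snd)
  moreover have "(\<lambda>x. grad_y h (x, snd z)) = (\<lambda>x. snd (G (x, snd z)))"
    using grad_y_eq_snd[OF G] by simp
  ultimately have der: "((\<lambda>x. grad_y h (x, snd z)) has_derivative (\<lambda>h. snd (D z (h, 0)))) (at (fst z))"
    by simp
  have "(\<lambda>h. snd (D z (h, 0)) \<bullet> w) = (\<lambda>h. h \<bullet> fst (D z (0, w)))"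
    using sym[of "(_, 0)" "(0, w)"] by (simp add: inner_prod_def)
  with has_derivative_inner_left[OF der, of w]
  have "GDERIV (\<lambda>x. grad_y h (x, snd z) \<bullet> w) (fst z) :> fst (D z (0, w))"
    by (simp add: gderiv_def)
  then have "gradient (\<lambda>x. grad_y h (x, snd z) \<bullet> w) (fst z) = fst (D z (0, w))"
    by (rule gradient_eqI)
  with hess_xy_works[OF differentiableI[OF der], of w] show ?thesis by simp
qed

section \<open>The bilevel problem satisfies the abstract hypotheses\<close>

lemma lower_value_minimum:
  assumes "y \<in> lower_solutions g x"
  shows "lower_value g x = g (x, y)"
  unfolding lower_value_def using assms
  by (intro cInf_eq_minimum) (auto simp: lower_solutions_def)

lemma positive_infimum_of_singular_values:
  assumes "0 < (INF z. sigma_min_pos (A z))"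
  obtains r where "0 < r" "\<And>z s. singular_value (A z) s \<Longrightarrow> 0 < s \<Longrightarrow> r \<le> s"
proof -
  obtain r where r: "0 < ereal r" "ereal r < (INF z. sigma_min_pos (A z))"
    using ereal_dense2[OF assms] by auto
  have "r \<le> s" if "singular_value (A z) s" "0 < s" for z s
  proof -
    have "ereal r \<le> sigma_min_pos (A z)" using r(2) by (meson INF_lower UNIV_I less_imp_le order_trans)
    also have "\<dots> \<le> ereal s" unfolding sigma_min_pos_def using that by (intro Inf_lower) auto
    finally show ?thesis by simp
  qed
  with r(1) that show ?thesis by simp
qed

text \<open>
The symmetry of the second derivative makes the Hessian block its own transpose, so that its
singular values are the roots of the eigenvalues of its square, as the abstract hypothesis has it.
\<close>
lemma bilevel_pl_instance:
  fixes f g :: "(real^'m) \<times> (real^'n) \<Rightarrow> real"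
  assumes wp: "well_posed_bilevel f g"
    and sm: "smoothness_assumption lf0 lf1 lg1 lg2 f g"
    and pl: "pl_assumption mu g"
  shows "\<exists>L \<mu> \<sigma> fs. bilevel_pl f g (gradient f) (gradient g) (hessian g) (lower_value g) L \<mu> \<sigma> fs"
proof -
  define L where "L = 1 + lf0 + lf1 + lg1 + lg2"
  have lip: "lf1-lipschitz_on UNIV (gradient f)" "lg1-lipschitz_on UNIV (gradient g)"
    "lg2-lipschitz_on UNIV (hessian g)" "\<And>x. lf0-lipschitz_on UNIV (\<lambda>y. f (x, y))"
    using sm by (auto simp: smoothness_assumption_def)
  have nn: "0 \<le> lf0" "0 \<le> lf1" "0 \<le> lg1" "0 \<le> lg2"
    using lip by (auto dest: lipschitz_on_nonneg)
  have toL: "norm (h a - h b) \<le> L * norm (a - b)"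
    if "C-lipschitz_on UNIV h" "C \<le> L" for h :: "'u::real_normed_vector \<Rightarrow> 'v::real_normed_vector" and C a b
    using order_trans[OF lipschitz_on_normD[OF that(1)] mult_right_mono[OF that(2)]] by simp
  have fG: "GDERIV f z :> gradient f z" and gG: "GDERIV g z :> gradient g z" for z
    using sm by (auto simp: smoothness_assumption_def intro!: GDERIV_gradient simp del: split_paired_All)
  have D: "(gradient g has_derivative blinfun_apply (hessian g z)) (at z)" for z
  proof -
    have "(gradient g has_derivative frechet_derivative (gradient g) (at z)) (at z)"
      using sm by (auto simp: smoothness_assumption_def frechet_derivative_works[symmetric] simp del: split_paired_All)
    then show ?thesis
      by (simp add: hessian_def bounded_linear_Blinfun_apply[OF has_derivative_bounded_linear])
  qed
  have sym: "u \<bullet> hessian g z v = hessian g z u \<bullet> v" for z u v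
    by (rule second_derivative_symmetric[OF gG D lipschitz_on_normD[OF lip(3)]]) auto
  obtain r where r: "0 < r" "\<And>z s. singular_value (hess_yy g z) s \<Longrightarrow> 0 < s \<Longrightarrow> r \<le> s"
    using pl positive_infimum_of_singular_values[of "hess_yy g"] by (auto simp: pl_assumption_def)
  have hyy: "hess_yy g z *v v = snd (hessian g z (0, v))" for z v
    by (rule hess_yy_eq[OF gG D])
  have transp: "transpose (hess_yy g z) = hess_yy g z" for z
  proof -
    have "transpose (hess_yy g z) *v u = hess_yy g z *v u" for u
    proof (rule vector_eq_rdot[THEN iffD1], rule allI)
      fix v
      show "(transpose (hess_yy g z) *v u) \<bullet> v = (hess_yy g z *v u) \<bullet> v"
        using sym[of "(0, u)" z "(0, v)"]
        by (simp add: transpose_matrix_vector dot_lmul_matrix hyy inner_prod_def)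
    qed
    then show ?thesis by (simp add: matrix_eq)
  qed
  have attained: "lower_solutions g x \<noteq> {}" for x using wp by (simp add: well_posed_bilevel_def)
  define fs where "fs = real_of_ereal (bilevel_value f g)"
  have "bilevel_pl f g (gradient f) (gradient g) (hessian g) (lower_value g) L (min mu 1) (min r 1) fs"
  proof
    show "GDERIV f z :> gradient f z" "GDERIV g z :> gradient g z"
      "(gradient g has_derivative blinfun_apply (hessian g z)) (at z)" for z
      by (fact fG gG D)+
    show "norm (gradient f z - gradient f z') \<le> L * norm (z - z')"
      "norm (gradient g z - gradient g z') \<le> L * norm (z - z')"
      "norm (hessian g z - hessian g z') \<le> L * norm (z - z')" for z z'
      using toL[OF lip(1)] toL[OF lip(2)] toL[OF lip(3)] nn by (auto simp: L_def)
    show "\<bar>f (x, y) - f (x, y')\<bar> \<le> L * norm (y - y')" for x y y'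
      using toL[OF lip(4), of x y y'] nn by (simp add: L_def)
    show "1 \<le> L" using nn by (simp add: L_def)
    show le: "lower_value g x \<le> g (x, y)" for x y
      using attained[of x] lower_value_minimum[of _ g x] by (auto simp: lower_solutions_def)
    show "\<exists>y. g (x, y) = lower_value g x" for x
      using attained[of x] lower_value_minimum[of _ g x] by fastforce
    show "2 * min mu 1 * (g (x, y) - lower_value g x) \<le> (norm (snd (gradient g (x, y))))\<^sup>2" for x y
    proof -
      have "2 * min mu 1 * (g (x, y) - lower_value g x) \<le> 2 * mu * (g (x, y) - lower_value g x)"
        using le by (intro mult_right_mono) auto
      also have "\<dots> \<le> (norm (grad_y g (x, y)))\<^sup>2" using pl by (simp add: pl_assumption_def)
      finally show ?thesis by (simp add: grad_y_eq_snd[OF gG])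
    qed
    show "0 < min mu 1" using pl by (simp add: pl_assumption_def)
    show "min mu 1 \<le> 1" "0 < min r 1" "min r 1 \<le> 1" using r by auto
    show "min r 1 \<le> s" if "0 < s" "v \<noteq> 0"
      "snd (hessian g z (0, snd (hessian g z (0, v)))) = s\<^sup>2 *\<^sub>R v" for s v z
    proof -
      have "singular_value (hess_yy g z) s"
        unfolding singular_value_def transp
        using that by (auto simp: matrix_vector_mul_assoc[symmetric] hyy intro!: exI[of _ v])
      then show ?thesis using r(2) that(1) by fastforce
    qed
    show "fs \<le> f (x, y)" if "g (x, y) = lower_value g x" for x y
    proof -
      have "y \<in> lower_solutions g x" using that le by (auto simp: lower_solutions_def)
      then have "bilevel_value f g \<le> ereal (f (x, y))"
        unfolding bilevel_value_def by (intro INF_lower) auto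
      moreover have "ereal fs = bilevel_value f g"
        using wp by (simp add: well_posed_bilevel_def fs_def ereal_real)
      ultimately show ?thesis by (metis ereal_less_eq(3))
    qed
  qed
  then show ?thesis by blast
qed

theorem theorem2:
  fixes f g :: "(real^'m) \<times> (real^'n) \<Rightarrow> real"
    and x0 :: "real^'m" and y0 :: "real^'n"
    and lf0 lf1 lg1 lg2 mu :: real
  assumes "well_posed_bilevel f g"
    and "smoothness_assumption lf0 lf1 lg1 lg2 f g"
    and "pl_assumption mu g"
  shows "\<exists>\<alpha>>0. \<exists>\<beta>>0. \<exists>\<rho>>0. \<exists>N\<ge>1. \<exists>T :: nat \<Rightarrow> nat.
    (\<forall>K. 1 \<le> T K) \<and>
    (\<lambda>K. real (T K)) \<in> O(\<lambda>K. ln (real K)) \<and>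
    (\<lambda>K. 1 / real K * (\<Sum>k<K. res_x f g (galet \<alpha> \<beta> \<rho> N (T K) f g x0 y0 k)))
      \<in> O(\<lambda>K. 1 / real K) \<and>
    (\<lambda>K. 1 / real K * (\<Sum>k<K. res_w f g (galet \<alpha> \<beta> \<rho> N (T K) f g x0 y0 k)))
      \<in> O(\<lambda>K. 1 / real K) \<and>
    (\<lambda>K. 1 / real K * (\<Sum>k<K. res_y g (galet \<alpha> \<beta> \<rho> N (T K) f g x0 y0 k)))
      \<in> O(\<lambda>K. 1 / real K)"
proof -
  obtain L \<mu> \<sigma> fs where
    loc: "bilevel_pl f g (gradient f) (gradient g) (hessian g) (lower_value g) L \<mu> \<sigma> fs"
    using bilevel_pl_instance[OF assms] by blast
  interpret bilevel_pl f g "gradient f" "gradient g" "hessian g" "lower_value g" L \<mu> \<sigma> fs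
    by (fact loc)
  have tr: "grad_x f z = fst (gradient f z)" "grad_y f z = snd (gradient f z)"
    "grad_y g z = snd (gradient g z)" "hess_yy g z *v v = H z v" "hess_xy g z *v v = J z v" for z v
    unfolding H_def J_def
    by (rule grad_x_eq_fst grad_y_eq_snd hess_yy_eq hess_xy_eq f_grad g_grad G_deriv D_symmetric)+
  obtain \<alpha> C where \<alpha>: "0 < \<alpha>" and sums: "\<And>T K x y w.
     x 0 = x0 \<Longrightarrow> y 0 = y0 \<Longrightarrow> w 0 = 0 \<Longrightarrow>
     (\<And>k. y (Suc k) = y k - (1 / (2 * L)) *\<^sub>R snd (gradient g (x k, y k))) \<Longrightarrow>
     (\<And>k. w (Suc k) = inner_w T (x k, y (Suc k))) \<Longrightarrow>
     (\<And>k. x (Suc k) = x k - \<alpha> *\<^sub>R (fst (gradient f (x k, y (Suc k))) + J (x k, y (Suc k)) (w (Suc k)))) \<Longrightarrow>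
     real K * (1 - \<sigma>\<^sup>2 / L\<^sup>2) ^ T \<le> 1 \<Longrightarrow>
     (\<Sum>k<K. (norm (fst (gradient f (x k, y k)) + J (x k, y k) (w k)))\<^sup>2) \<le> C \<and>
     (\<Sum>k<K. (norm (H (x k, y k) (snd (gradient f (x k, y k)) + H (x k, y k) (w k))))\<^sup>2) \<le> C \<and>
     (\<Sum>k<K. R (x k, y k)) \<le> C"
    using residual_sums_bounded[of x0 y0] by blast
  define a where "a = \<sigma>\<^sup>2 / L\<^sup>2"
  have a: "0 < a" "a \<le> 1" using contraction_factor sigma L_pos by (auto simp: a_def)
  define T where "T K = nat \<lceil>ln (real K) / a\<rceil> + 1" for K
  note T = logarithmic_iteration_count[OF a, folded T_def]
  define G where "G K = galet \<alpha> (1 / (2 * L)) (1 / L\<^sup>2) 1 (T K) f g x0 y0" for K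
  have bounds: "(\<Sum>k<K. res_x f g (G K k)) \<le> C \<and> (\<Sum>k<K. res_w f g (G K k)) \<le> C
      \<and> (\<Sum>k<K. res_y g (G K k)) \<le> C" for K
  proof -
    define x where "x k = fst (G K k)" for k
    define y where "y k = fst (snd (G K k))" for k
    define w where "w k = snd (snd (G K k))" for k
    have eq: "G K k = (x k, y k, w k)" for k by (simp add: x_def y_def w_def)
    have step: "(x (Suc k), y (Suc k), w (Suc k)) =
        galet_step \<alpha> (1 / (2 * L)) (1 / L\<^sup>2) 1 (T K) f g (x k, y k, w k)" for k
      unfolding eq[symmetric] by (simp add: G_def)
    have y: "y (Suc k) = y k - (1 / (2 * L)) *\<^sub>R snd (gradient g (x k, y k))" for k
      using step[of k] by (simp add: galet_step_def Let_def y_step_def tr)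
    have w: "w (Suc k) = inner_w (T K) (x k, y (Suc k))" for k
      using step[of k] unfolding galet_step_def Let_def w_step_def inner_w_def tr by simp
    have x: "x (Suc k) = x k - \<alpha> *\<^sub>R (fst (gradient f (x k, y (Suc k))) + J (x k, y (Suc k)) (w (Suc k)))" for k
      using step[of k] unfolding galet_step_def Let_def tr by simp
    have 0: "x 0 = x0" "y 0 = y0" "w 0 = 0" by (simp_all add: x_def y_def w_def G_def)
    show ?thesis
      using sums[OF 0 y w x T(1)[of K, unfolded a_def]]
      by (simp add: eq res_x_def res_w_def res_y_def tr R_def)
  qed
  have nonneg: "0 \<le> (\<Sum>k<K. res_x f g (G K k))" "0 \<le> (\<Sum>k<K. res_w f g (G K k))"
    "0 \<le> (\<Sum>k<K. res_y g (G K k))" for K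
    by (auto simp: res_x_def res_w_def res_y_def gs_le split: prod.splits intro!: sum_nonneg)
  have mean: "(\<lambda>K. 1 / real K * (\<Sum>k<K. res_x f g (G K k))) \<in> O(\<lambda>K. 1 / real K)"
    "(\<lambda>K. 1 / real K * (\<Sum>k<K. res_w f g (G K k))) \<in> O(\<lambda>K. 1 / real K)"
    "(\<lambda>K. 1 / real K * (\<Sum>k<K. res_y g (G K k))) \<in> O(\<lambda>K. 1 / real K)"
    using bounds by (intro bounded_sums_imp_mean_bigo[where C = C] nonneg; blast)+
  have "0 < 1 / (2 * L)" "0 < 1 / L\<^sup>2" "1 \<le> (1::nat)" "\<forall>K. 1 \<le> T K"
    using L_pos by (auto simp: T_def)
  with \<alpha> T(2) mean show ?thesis unfolding G_def by blast
qed

end
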